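(* Let $\sigma>0$ and let $(Y_1,X_1),\dots,(Y_n,X_n)$ be an i.i.d. sample of $(Y,X)$ obeying $Y=\int_0^1\beta(t)X(t)\,dt+\sigma\epsilon$. Suppose that $\epsilon\sim\mathcal N(0,1)$ is independent of the second order stationary regressor $X$, whose covariance operator $T$ has associated sequence of eigenvalues $(\lambda_j)_{j\ge1}\in\mathcal S_\upsilon^d$, $d\ge1$. Let $p\ge0$ and $\rho>0$. Then for any estimator $\breve\beta$ (based on the sample): (i) in the polynomial case, i.e. $\upsilon_1=1$ and $\upsilon_j=j^{-2a}$, $j\ge2$, for some $a>1/2$, $$\sup_{\beta\in\mathcal W_p^\rho}\mathbb E\langle T(\breve\beta-\beta),\breve\beta-\beta\rangle\gtrsim n^{-(2p+2a)/(2p+2a+1)};$$ (ii) in the exponential case, i.e. $\upsilon_1=1$ and $\upsilon_j=\exp(-j^{2a})$, $j\ge2$, for some $a>0$, $$\sup_{\beta\in\mathcal W_p^\rho}\mathbb E\langle T(\breve\beta-\beta),\breve\beta-\beta\rangle\gtrsim n^{-1}(\log n)^{1/(2a)}.$$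
   Context: $L^2[0,1]$ has its usual inner product $\langle\cdot,\cdot\rangle$ and norm $\|\cdot\|$. Model: $Y=\int_0^1\beta(t)X(t)dt+\sigma\epsilon$, where $\beta\in L^2[0,1]$, $X$ is a random function with values in $L^2[0,1]$, centered, with $\mathbb E\|X\|^2<\infty$, and $\epsilon$ is a real error term with mean zero and variance one. The expectation is taken under the distribution of the sample with slope $\beta$. Trigonometric basis of $L^2[0,1]$: $\psi_1\equiv1$, $\psi_{2j}(s)=\sqrt2\cos(2\pi js)$, $\psi_{2j+1}(s)=\sqrt2\sin(2\pi js)$, $j\in\mathbb N=\{1,2,\dots\}$. $X$ is second order stationary: $\mathrm{Cov}(X(t),X(s))=c(t-s)$ for $s,t\in[0,1]$, with $c:[-1,1]\to\mathbb R$ positive definite. Its covariance operator is $(Tf)(s)=\int_0^1\mathrm{Cov}(X(t),X(s))f(t)dt$. Standing property: $T$ is strictly positive and diagonal in the trigonometric basis, $T\psi_j=\lambda_j\psi_j$ with $\lambda_j=\mathbb E\langle X,\psi_j\rangle^2>0$ for all $j\ge1$. For $d\ge1$: $\mathcal S_\upsilon^d=\{(\lambda_j)_{j\ge1}:1/d\le\lambda_j/\upsilon_j\le d\ \ \forall j\in\mathbb N\}$. Weights: $w_1^p=1$, $w_{2j}^p=w_{2j+1}^p=j^{2p}$ for $j\in\mathbb N$. The Sobolev ellipsoid of periodic functions is $\mathcal W_p^\rho=\{f\in L^2[0,1]:\sum_{j\ge1}w_j^p|\langle f,\psi_j\rangle|^2\le\rho\}$ (for $p=0$ this is an ellipsoid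 in $L^2[0,1]$ without smoothness restriction). $a_n\gtrsim b_n$ means that there is $C>0$ with $b_n\le C\,a_n$ for all sufficiently large $n$; here $C$ may depend on the fixed parameters but not on $n$. *)

theory Defs
  imports "HOL-Probability.Probability"
begin

section \<open>The space $L^2[0,1]$\<close>

text \<open>Elements of $L^2[0,1]$ are represented by functions on \<open>real\<close>; their values outside the
  unit interval and on null sets are irrelevant.\<close>

definition lborel01 :: "real measure" where
  "lborel01 = restrict_space lborel {0..1}"

definition L2_01 :: "(real \<Rightarrow> real) set" where
  "L2_01 = {f. f \<in> borel_measurable lborel01 \<and> integrable lborel01 (\<lambda>t. (f t)\<^sup>2)}"

definition inner01 :: "(real \<Rightarrow> real) \<Rightarrow> (real \<Rightarrow> real) \<Rightarrow> real" where
  "inner01 f g = (\<integral>t. f t * g t \<partial>lborel01)"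

definition norm01 :: "(real \<Rightarrow> real) \<Rightarrow> real" where
  "norm01 f = sqrt (inner01 f f)"

text \<open>The $\sigma$-algebra generated by the continuous linear functionals. Since $L^2[0,1]$ is
  separable, this is its Borel $\sigma$-algebra. Only the space and the sets of this measure are
  used.\<close>

definition borel_L2 :: "(real \<Rightarrow> real) measure" where
  "borel_L2 = sigma L2_01 {{f \<in> L2_01. inner01 f g \<in> B} | g B. g \<in> L2_01 \<and> B \<in> sets borel}"

text \<open>All sequences below are indexed by the positive integers; values at index \<open>0\<close> are
  never used.\<close>

definition trig :: "nat \<Rightarrow> real \<Rightarrow> real" where
  "trig j s =
    (if j \<le> 1 then 1
     else if even j then sqrt 2 * cos (2 * pi * real (j div 2) * s)
     else sqrt 2 * sin (2 * pi * real (j div 2) * s))"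

definition sobolev_weight :: "real \<Rightarrow> nat \<Rightarrow> real" where
  "sobolev_weight p j = (if j \<le> 1 then 1 else real (j div 2) powr (2 * p))"

definition sobolev_ellipsoid :: "real \<Rightarrow> real \<Rightarrow> (real \<Rightarrow> real) set" where
  "sobolev_ellipsoid p \<rho> =
    {f \<in> L2_01.
      (\<lambda>j. sobolev_weight p j * \<bar>inner01 f (trig j)\<bar>\<^sup>2) summable_on {1..} \<and>
      (\<Sum>\<^sub>\<infinity>j\<in>{1..}. sobolev_weight p j * \<bar>inner01 f (trig j)\<bar>\<^sup>2) \<le> \<rho>}"


section \<open>Second order stationary regressors\<close>

definition cov :: "'w measure \<Rightarrow> ('w \<Rightarrow> real) \<Rightarrow> ('w \<Rightarrow> real) \<Rightarrow> real" where
  "cov M U V = (\<integral>\<omega>. (U \<omega> - (\<integral>\<omega>'. U \<omega>' \<partial>M)) * (V \<omega> - (\<integral>\<omega>'. V \<omega>' \<partial>M)) \<partial>M)"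

definition cov_operator ::
  "'w measure \<Rightarrow> ('w \<Rightarrow> real \<Rightarrow> real) \<Rightarrow> (real \<Rightarrow> real) \<Rightarrow> real \<Rightarrow> real" where
  "cov_operator M X f s = (\<integral>t. cov M (\<lambda>\<omega>. X \<omega> t) (\<lambda>\<omega>. X \<omega> s) * f t \<partial>lborel01)"

definition positive_definite_fun :: "(real \<Rightarrow> real) \<Rightarrow> bool" where
  "positive_definite_fun c \<longleftrightarrow>
    (\<forall>(m::nat) (t :: nat \<Rightarrow> real) (x :: nat \<Rightarrow> real). (\<forall>i<m. t i \<in> {0..1}) \<longrightarrow>
      0 \<le> (\<Sum>i<m. \<Sum>k<m. x i * x k * c (t i - t k)))"

locale second_order_stationary_regressor = prob_space M
  for M :: "'w measure" +
  fixes X :: "'w \<Rightarrow> real \<Rightarrow> real"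
    and c :: "real \<Rightarrow> real"
    and lam :: "nat \<Rightarrow> real"
  assumes jointly_measurable: "(\<lambda>(\<omega>, t). X \<omega> t) \<in> borel_measurable (M \<Otimes>\<^sub>M lborel01)"
    and in_L2: "\<And>\<omega>. \<omega> \<in> space M \<Longrightarrow> X \<omega> \<in> L2_01"
    and second_moment: "integrable M (\<lambda>\<omega>. (norm01 (X \<omega>))\<^sup>2)"
    and second_moment_at: "\<And>t. t \<in> {0..1} \<Longrightarrow> integrable M (\<lambda>\<omega>. (X \<omega> t)\<^sup>2)"
    and centered: "\<And>t. t \<in> {0..1} \<Longrightarrow> expectation (\<lambda>\<omega>. X \<omega> t) = 0"
    and stationary: "\<And>s t. s \<in> {0..1} \<Longrightarrow> t \<in> {0..1} \<Longrightarrow>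
      cov M (\<lambda>\<omega>. X \<omega> t) (\<lambda>\<omega>. X \<omega> s) = c (t - s)"
    and positive_definite: "positive_definite_fun c"
    and strictly_positive: "\<And>f. f \<in> L2_01 \<Longrightarrow> \<not> (AE t in lborel01. f t = 0) \<Longrightarrow>
      inner01 (cov_operator M X f) f > 0"
    and diagonal: "\<And>j. j \<ge> 1 \<Longrightarrow>
      (AE s in lborel01. cov_operator M X (trig j) s = lam j * trig j s)"
    and eigenvalue: "\<And>j. j \<ge> 1 \<Longrightarrow> lam j = expectation (\<lambda>\<omega>. (inner01 (X \<omega>) (trig j))\<^sup>2)"
    and eigenvalue_pos: "\<And>j. j \<ge> 1 \<Longrightarrow> lam j > 0"

definition eigenvalue_class :: "(nat \<Rightarrow> real) \<Rightarrow> real \<Rightarrow> (nat \<Rightarrow> real) set" where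
  "eigenvalue_class \<upsilon> d = {lam. \<forall>j\<ge>1. 1 / d \<le> lam j / \<upsilon> j \<and> lam j / \<upsilon> j \<le> d}"

definition poly_rate_seq :: "real \<Rightarrow> nat \<Rightarrow> real" where
  "poly_rate_seq a j = (if j \<le> 1 then 1 else real j powr (- 2 * a))"

definition exp_rate_seq :: "real \<Rightarrow> nat \<Rightarrow> real" where
  "exp_rate_seq a j = (if j \<le> 1 then 1 else exp (- (real j powr (2 * a))))"


section \<open>The functional linear model\<close>

text \<open>The error variable and the regressor take values in different types, so independence is
  expressed through the $\sigma$-algebras they generate.\<close>

definition standard_normal_indep_error ::
  "'w measure \<Rightarrow> ('w \<Rightarrow> real \<Rightarrow> real) \<Rightarrow> ('w \<Rightarrow> real) \<Rightarrow> bool" where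
  "standard_normal_indep_error M X \<epsilon> \<longleftrightarrow>
    distributed M lborel \<epsilon> std_normal_density \<and>
    prob_space.indep_set M
      (sets (vimage_algebra (space M) \<epsilon> borel)) (sets (vimage_algebra (space M) X borel_L2))"

definition observation_law ::
  "'w measure \<Rightarrow> ('w \<Rightarrow> real \<Rightarrow> real) \<Rightarrow> ('w \<Rightarrow> real) \<Rightarrow> real \<Rightarrow> (real \<Rightarrow> real)
    \<Rightarrow> (real \<times> (real \<Rightarrow> real)) measure" where
  "observation_law M X \<epsilon> \<sigma> \<beta> =
    distr M (borel \<Otimes>\<^sub>M borel_L2) (\<lambda>\<omega>. (inner01 \<beta> (X \<omega>) + \<sigma> * \<epsilon> \<omega>, X \<omega>))"

definition sample_law ::
  "'w measure \<Rightarrow> ('w \<Rightarrow> real \<Rightarrow> real) \<Rightarrow> ('w \<Rightarrow> real) \<Rightarrow> real \<Rightarrow> nat \<Rightarrow> (real \<Rightarrow> real)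
    \<Rightarrow> (nat \<Rightarrow> real \<times> (real \<Rightarrow> real)) measure" where
  "sample_law M X \<epsilon> \<sigma> n \<beta> = PiM {..<n} (\<lambda>_. observation_law M X \<epsilon> \<sigma> \<beta>)"

definition estimators :: "nat \<Rightarrow> ((nat \<Rightarrow> real \<times> (real \<Rightarrow> real)) \<Rightarrow> real \<Rightarrow> real) set" where
  "estimators n = measurable (PiM {..<n} (\<lambda>_. borel \<Otimes>\<^sub>M borel_L2)) borel_L2"

text \<open>The loss is nonnegative, so its expectation always exists in $[0,\infty]$.\<close>

definition prediction_risk ::
  "'w measure \<Rightarrow> ('w \<Rightarrow> real \<Rightarrow> real) \<Rightarrow> ('w \<Rightarrow> real) \<Rightarrow> real \<Rightarrow> nat
    \<Rightarrow> ((nat \<Rightarrow> real \<times> (real \<Rightarrow> real)) \<Rightarrow> real \<Rightarrow> real) \<Rightarrow> (real \<Rightarrow> real) \<Rightarrow> ennreal" where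
  "prediction_risk M X \<epsilon> \<sigma> n est \<beta> =
    (\<integral>\<^sup>+ D. ennreal (inner01 (cov_operator M X (\<lambda>t. est D t - \<beta> t)) (\<lambda>t. est D t - \<beta> t))
      \<partial>sample_law M X \<epsilon> \<sigma> n \<beta>)"

end

theory Submission
  imports Defs "HOL-Real_Asymp.Real_Asymp"
begin

text \<open>
  The lower bound is Assouad's hypercube argument. Fix \<open>n\<close>, a dimension \<open>m\<close> and a constant
  \<open>\<kappa>\<close>, put \<open>b\<^sub>j\<^sup>2 = \<kappa> / (n \<lambda>\<^sub>j)\<close>, and consider the \<open>2\<^sup>m\<close> slopes with coefficients
  \<open>\<plusminus>b\<^sub>j\<close> in the trigonometric basis for \<open>j \<le> m\<close> and zero beyond. Three facts
  give the bound.

  First, the loss decouples over coordinates. Since \<open>T\<close> is the covariance operator of the centered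
  \<open>X\<close>, Fubini gives \<open>\<langle>Tf, f\<rangle> = E \<langle>X, f\<rangle>\<^sup>2\<close>, and the scores \<open>\<langle>X, \<psi>\<^sub>j\<rangle>\<close> are uncorrelated with variances
  \<open>\<lambda>\<^sub>j\<close>. Bessel's inequality for the first \<open>m\<close> scores bounds the loss from below by
  \<open>\<Sum>\<^bsub>j\<le>m\<^esub> \<lambda>\<^sub>j \<langle>f, \<psi>\<^sub>j\<rangle>\<^sup>2\<close> (\<open>cov_operator_Bessel\<close>).

  Second, two slopes that differ in one sign are statistically indistinguishable. Given \<open>X\<close>, the
  response is Gaussian with variance \<open>\<sigma>\<^sup>2\<close>, so the Hellinger affinity of one observation under the
  slopes \<open>\<beta>\<close> and \<open>\<beta>'\<close> equals \<open>E exp (- \<langle>X, \<beta> - \<beta>'\<rangle>\<^sup>2 / (8 \<sigma>\<^sup>2))\<close>. This is at least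
  \<open>1 - E \<langle>X, \<beta> - \<beta>'\<rangle>\<^sup>2 / (8 \<sigma>\<^sup>2)\<close>, a quantity that the eigenvalues determine.
  For slopes that differ only in coordinate \<open>j\<close> it is
  \<open>1 - \<kappa> / (2 n \<sigma>\<^sup>2)\<close>, and its \<open>n\<close>-th power, the affinity of the samples, is at least one half as soon as
  \<open>\<kappa> \<le> \<sigma>\<^sup>2\<close> (\<open>sample_affinity\<close>). Hence the sum of the two risks in this coordinate is at
  least \<open>\<lambda>\<^sub>j b\<^sub>j\<^sup>2 / 2 = \<kappa> / (2 n)\<close> (\<open>two_point_quadratic_risk\<close>).

  Third, averaging over the hypercube (\<open>Assouad_averaging\<close>) adds up these bounds, so the largest risk
  is at least \<open>\<kappa> m / (4 n)\<close> (\<open>minimax_lower_bound\<close>).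

  The only constraint on \<open>m\<close> is that the hypercube lies in the ellipsoid, that is
  \<open>\<kappa> \<Sum>\<^bsub>j\<le>m\<^esub> w\<^sub>j / \<lambda>\<^sub>j \<le> \<rho> n\<close>. In the polynomial case the sum is of order \<open>m\<close> to the power
  \<open>2p + 2a + 1\<close>, which allows \<open>m\<close> of order \<open>n\<close> to the power \<open>1 / (2p + 2a + 1)\<close>; in the exponential
  case its growth is exponential in \<open>m\<close> to the power \<open>2a\<close>, and \<open>m\<close> may be of order \<open>ln n\<close>
  to the power \<open>1 / (2a)\<close>. In both cases \<open>m / n\<close> is the asserted rate up to a constant.
\<close>

section \<open>The geometry of $L^2[0,1]$\<close>

lemma space_lborel01 [simp]: "space lborel01 = {0..1}"
  by (simp add: lborel01_def space_restrict_space)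

lemma prob_space_lborel01: "prob_space lborel01"
  by standard (simp add: lborel01_def emeasure_restrict_space space_restrict_space)

lemma measurable_lborel01:
  assumes "f \<in> borel_measurable borel"
  shows "f \<in> borel_measurable lborel01"
  unfolding lborel01_def using assms by (intro measurable_restrict_space1) simp

lemma L2_01_measurable [measurable_dest]: "f \<in> L2_01 \<Longrightarrow> f \<in> borel_measurable lborel01"
  by (simp add: L2_01_def)

lemma L2_01_square_integrable: "f \<in> L2_01 \<Longrightarrow> integrable lborel01 (\<lambda>t. (f t)\<^sup>2)"
  by (simp add: L2_01_def)

lemma integrable_product_of_squares:
  fixes f g :: "'a \<Rightarrow> real"
  assumes "f \<in> borel_measurable N" "g \<in> borel_measurable N"
    and f2: "integrable N (\<lambda>t. (f t)\<^sup>2)" and g2: "integrable N (\<lambda>t. (g t)\<^sup>2)"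
  shows "integrable N (\<lambda>t. f t * g t)"
proof (rule Bochner_Integration.integrable_bound)
  show "integrable N (\<lambda>t. (f t)\<^sup>2 + (g t)\<^sup>2)"
    using f2 g2 by simp
  have "\<bar>x * y\<bar> \<le> x\<^sup>2 + y\<^sup>2" for x y :: real
    using sum_squares_bound[of "\<bar>x\<bar>" "\<bar>y\<bar>"] abs_mult[of x y] by simp
  then show "AE t in N. norm (f t * g t) \<le> norm ((f t)\<^sup>2 + (g t)\<^sup>2)"
    by (intro AE_I2) (simp add: abs_mult)
qed (use assms in measurable)

lemma L2_01_product_integrable:
  assumes "f \<in> L2_01" "g \<in> L2_01"
  shows "integrable lborel01 (\<lambda>t. f t * g t)"
  using assms unfolding L2_01_def by (auto intro: integrable_product_of_squares)

lemma L2_01_scale: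
  assumes "f \<in> L2_01"
  shows "(\<lambda>t. r * f t) \<in> L2_01"
  using assms unfolding L2_01_def by (auto simp: power_mult_distrib)

lemma L2_01_add:
  assumes "f \<in> L2_01" "g \<in> L2_01"
  shows "(\<lambda>t. f t + g t) \<in> L2_01"
proof -
  have "integrable lborel01 (\<lambda>t. (f t)\<^sup>2 + (g t)\<^sup>2 + 2 * (f t * g t))"
    using assms L2_01_product_integrable[OF assms] by (simp add: L2_01_def)
  then show ?thesis
    using assms by (auto simp: L2_01_def power2_sum algebra_simps)
qed

lemma L2_01_diff:
  assumes "f \<in> L2_01" "g \<in> L2_01"
  shows "(\<lambda>t. f t - g t) \<in> L2_01"
  using L2_01_add[OF assms(1) L2_01_scale[OF assms(2), of "-1"]] by simp

lemma L2_01_sum: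
  assumes "finite J" "\<And>j. j \<in> J \<Longrightarrow> f j \<in> L2_01"
  shows "(\<lambda>t. \<Sum>j\<in>J. f j t) \<in> L2_01"
  using assms
proof (induction J rule: finite_induct)
  case empty
  then show ?case by (simp add: L2_01_def)
next
  case (insert j J)
  then show ?case by (simp add: L2_01_add)
qed

lemma inner01_commute: "inner01 f g = inner01 g f"
  by (simp add: inner01_def mult.commute)

lemma inner01_scale: "inner01 (\<lambda>t. r * f t) g = r * inner01 f g"
  by (simp add: inner01_def mult.assoc)

lemma inner01_diff:
  assumes "f \<in> L2_01" "g \<in> L2_01" "h \<in> L2_01"
  shows "inner01 (\<lambda>t. f t - g t) h = inner01 f h - inner01 g h"
  using L2_01_product_integrable[OF assms(1,3)] L2_01_product_integrable[OF assms(2,3)]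
  by (simp add: inner01_def left_diff_distrib)

lemma inner01_sum:
  assumes "\<And>j. j \<in> J \<Longrightarrow> f j \<in> L2_01" "h \<in> L2_01"
  shows "inner01 (\<lambda>t. \<Sum>j\<in>J. f j t) h = (\<Sum>j\<in>J. inner01 (f j) h)"
  using L2_01_product_integrable[OF assms]
  by (simp add: inner01_def sum_distrib_right)

text \<open>The squared norm of \<open>\<parallel>f\<parallel>\<^sup>2 g - \<langle>f, g\<rangle> f\<close> is nonnegative and has \<open>\<parallel>f\<parallel>\<^sup>2\<close> as a factor; the
  case where that factor vanishes has to be treated by itself.\<close>

lemma inner01_Cauchy_Schwarz:
  assumes "f \<in> L2_01" "g \<in> L2_01"
  shows "(inner01 f g)\<^sup>2 \<le> inner01 f f * inner01 g g"
proof -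
  define F G U where "F = inner01 f f" and "G = inner01 g g" and "U = inner01 f g"
  have "F \<ge> 0"
    unfolding F_def inner01_def by (rule integral_nonneg_AE) simp
  show ?thesis
  proof (cases "F = 0")
    case True
    then have "AE t in lborel01. f t = 0"
      using integral_nonneg_eq_0_iff_AE[OF L2_01_square_integrable[OF assms(1)]]
      by (simp add: F_def inner01_def power2_eq_square)
    then have "AE t in lborel01. f t * g t = 0" by auto
    then have "U = 0"
      unfolding U_def inner01_def by (rule integral_eq_zero_AE)
    then show ?thesis using True by (simp add: U_def F_def)
  next
    case False
    let ?h = "\<lambda>t. F * g t - U * f t"
    have h: "?h \<in> L2_01"
      using assms by (intro L2_01_diff L2_01_scale)
    have *: "inner01 ?h k = F * inner01 g k - U * inner01 f k" if "k \<in> L2_01" for k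
      using that assms by (simp add: inner01_diff L2_01_scale inner01_scale)
    have "0 \<le> inner01 ?h ?h"
      unfolding inner01_def by (rule integral_nonneg_AE) simp
    also have "\<dots> = F * (F * G - U * U) - U * (F * U - U * F)"
      by (subst *[OF h],
          simp only: inner01_commute[of g ?h] inner01_commute[of f ?h] *[OF assms(1)] *[OF assms(2)])
         (simp add: F_def G_def U_def inner01_commute)
    finally have "0 \<le> F * (F * G - U * U)" by (simp add: algebra_simps)
    then show ?thesis
      using False \<open>F \<ge> 0\<close> by (simp add: zero_le_mult_iff F_def G_def U_def power2_eq_square)
  qed
qed

lemma space_borel_L2 [simp]: "space borel_L2 = L2_01"
  unfolding borel_L2_def by (rule space_measure_of) auto

lemma inner01_measurable_borel_L2:
  assumes "g \<in> L2_01"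
  shows "(\<lambda>f. inner01 f g) \<in> borel_measurable borel_L2"
proof (rule measurableI)
  fix B :: "real set" assume "B \<in> sets borel"
  then have "{f \<in> L2_01. inner01 f g \<in> B} \<in> sets borel_L2"
    using assms unfolding borel_L2_def by (intro in_measure_of) auto
  moreover have "(\<lambda>f. inner01 f g) -` B \<inter> space borel_L2 = {f \<in> L2_01. inner01 f g \<in> B}"
    by auto
  ultimately show "(\<lambda>f. inner01 f g) -` B \<inter> space borel_L2 \<in> sets borel_L2" by simp
qed simp


section \<open>The trigonometric system\<close>

lemma trig_measurable [measurable]: "trig j \<in> borel_measurable borel"
  unfolding trig_def[abs_def] by measurable

lemma abs_trig_le: "\<bar>trig j s\<bar> \<le> sqrt 2"
  by (auto simp: trig_def abs_mult intro!: mult_left_le)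

lemma trig_L2_01: "trig j \<in> L2_01"
proof -
  interpret prob_space lborel01 by (rule prob_space_lborel01)
  have [measurable]: "trig j \<in> borel_measurable lborel01"
    by (intro measurable_lborel01) simp
  have "(trig j s)\<^sup>2 \<le> (sqrt 2)\<^sup>2" for s
    by (rule power2_le_iff_abs_le[THEN iffD2]) (simp_all add: abs_trig_le)
  then have "integrable lborel01 (\<lambda>s. (trig j s)\<^sup>2)"
    by (intro integrable_const_bound[of _ 2]) simp_all
  then show ?thesis by (simp add: L2_01_def)
qed

lemma has_bochner_integral_lborel01_FTC:
  fixes f F :: "real \<Rightarrow> real"
  assumes "\<And>x. DERIV F x :> f x" "\<And>x. isCont f x"
  shows "has_bochner_integral lborel01 f (F 1 - F 0)"
proof -
  have *: "has_bochner_integral lborel (\<lambda>x. f x * indicator {0..1} x) (F 1 - F 0)"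
    using assms by (intro has_bochner_integral_FTC_Icc_real) auto
  show ?thesis
    using * unfolding has_bochner_integral_iff lborel01_def
    by (simp add: integrable_restrict_space integral_restrict_space mult.commute)
qed

lemma integral_cos_lborel01:
  fixes k :: int
  shows "has_bochner_integral lborel01 (\<lambda>s. cos (2 * pi * k * s)) (if k = 0 then 1 else 0)"
proof (cases "k = 0")
  case True
  show ?thesis
    using has_bochner_integral_lborel01_FTC[of "\<lambda>x. x" "\<lambda>_. 1"] True by simp
next
  case False
  have "sin (2 * pi * real_of_int k) = 0"
    by (metis mult.commute mult.assoc sin_int_2pin)
  moreover have "has_bochner_integral lborel01 (\<lambda>s. cos (2 * pi * k * s))
      (sin (2 * pi * k * 1) / (2 * pi * k) - sin (2 * pi * k * 0) / (2 * pi * k))"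
    using False by (intro has_bochner_integral_lborel01_FTC) (auto intro!: derivative_eq_intros)
  ultimately show ?thesis using False by simp
qed

lemma integral_sin_lborel01:
  fixes k :: int
  shows "has_bochner_integral lborel01 (\<lambda>s. sin (2 * pi * k * s)) 0"
proof (cases "k = 0")
  case True
  then show ?thesis
    using has_bochner_integral_zero[of lborel01] by simp
next
  case False
  have "cos (2 * pi * real_of_int k) = 1"
    by (metis mult.commute mult.assoc cos_int_2pin)
  moreover have "has_bochner_integral lborel01 (\<lambda>s. sin (2 * pi * k * s))
      (- cos (2 * pi * k * 1) / (2 * pi * k) - (- cos (2 * pi * k * 0) / (2 * pi * k)))"
    using False by (intro has_bochner_integral_lborel01_FTC) (auto intro!: derivative_eq_intros)
  ultimately show ?thesis using False by simp
qed

text \<open>Writing the constant function as a cosine of frequency zero leaves only two shapes to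
  multiply in the orthogonality relations; the amplitude \<open>r\<close> records the different normalization.\<close>

lemma trig_cases:
  assumes "j \<ge> 1"
  obtains (cosine) m :: nat and r :: real
      where "trig j = (\<lambda>s. r * cos (2 * pi * m * s))"
        "m = 0 \<and> j = 1 \<and> r = 1 \<or> m > 0 \<and> j = 2 * m \<and> r = sqrt 2"
  | (sine) m :: nat
      where "trig j = (\<lambda>s. sqrt 2 * sin (2 * pi * m * s))" "m > 0" "j = 2 * m + 1"
proof -
  consider "j = 1" | "j > 1" "even j" | "j > 1" "odd j"
    using assms by linarith
  then show thesis
  proof cases
    case 1
    then have "trig j = (\<lambda>s. 1 * cos (2 * pi * real 0 * s))" by (auto simp: trig_def)
    with 1 show thesis by (intro cosine) auto
  next
    case 2
    then have "trig j = (\<lambda>s. sqrt 2 * cos (2 * pi * real (j div 2) * s))"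
      by (auto simp: trig_def)
    moreover from 2 have "j div 2 > 0 \<and> j = 2 * (j div 2) \<and> sqrt 2 = sqrt 2" by auto
    ultimately show thesis by (blast intro: cosine)
  next
    case 3
    then have "trig j = (\<lambda>s. sqrt 2 * sin (2 * pi * real (j div 2) * s))"
      by (auto simp: trig_def)
    moreover from 3 have "j div 2 > 0" "j = 2 * (j div 2) + 1" by presburger+
    ultimately show thesis by (blast intro: sine)
  qed
qed

text \<open>The product-to-sum formulas turn each product into cosines and sines of integer frequency,
  whose integrals over the unit interval vanish, the cosine of frequency zero excepted.\<close>

lemma trig_orthonormal:
  assumes "i \<ge> 1" "j \<ge> 1"
  shows "inner01 (trig i) (trig j) = (if i = j then 1 else 0)"
proof -
  have cos_cos: "inner01 (\<lambda>s. r * cos (2 * pi * real m * s)) (\<lambda>s. r' * cos (2 * pi * real m' * s))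
      = r * r' * ((if m = m' then 1 else 0) + (if m = 0 \<and> m' = 0 then 1 else 0)) / 2"
    for r r' m m'
  proof -
    have "has_bochner_integral lborel01
        (\<lambda>s. r * r' * (cos (2 * pi * (int m - int m') * s) + cos (2 * pi * (int m + int m') * s)) / 2)
        (r * r' * ((if int m - int m' = 0 then 1 else 0) + (if int m + int m' = 0 then 1 else 0)) / 2)"
      by (intro has_bochner_integral_divide_zero has_bochner_integral_mult_right
          has_bochner_integral_add integral_cos_lborel01)
    then show ?thesis
      unfolding inner01_def
      by (subst has_bochner_integral_integral_eq) (auto simp: cos_add cos_diff algebra_simps)
  qed
  have sin_sin: "inner01 (\<lambda>s. r * sin (2 * pi * real m * s)) (\<lambda>s. r' * sin (2 * pi * real m' * s))
      = r * r' * ((if m = m' then 1 else 0) - (if m = 0 \<and> m' = 0 then 1 else 0)) / 2"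
    for r r' m m'
  proof -
    have "has_bochner_integral lborel01
        (\<lambda>s. r * r' * (cos (2 * pi * (int m - int m') * s) - cos (2 * pi * (int m + int m') * s)) / 2)
        (r * r' * ((if int m - int m' = 0 then 1 else 0) - (if int m + int m' = 0 then 1 else 0)) / 2)"
      by (intro has_bochner_integral_divide_zero has_bochner_integral_mult_right
          has_bochner_integral_diff integral_cos_lborel01)
    then show ?thesis
      unfolding inner01_def
      by (subst has_bochner_integral_integral_eq) (auto simp: cos_add cos_diff algebra_simps)
  qed
  have sin_cos: "inner01 (\<lambda>s. r * sin (2 * pi * real m * s)) (\<lambda>s. r' * cos (2 * pi * real m' * s)) = 0"
    for r r' m m'
  proof -
    have "has_bochner_integral lborel01
        (\<lambda>s. r * r' * (sin (2 * pi * (int m + int m') * s) + sin (2 * pi * (int m - int m') * s)) / 2)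
        (r * r' * (0 + 0) / 2)"
      by (intro has_bochner_integral_divide_zero has_bochner_integral_mult_right
          has_bochner_integral_add integral_sin_lborel01)
    then show ?thesis
      unfolding inner01_def
      by (intro has_bochner_integral_integral_eq) (simp add: sin_add sin_diff algebra_simps)
  qed
  from assms(1) show ?thesis
  proof (cases i rule: trig_cases)
    case i: (cosine m r)
    from assms(2) show ?thesis
    proof (cases j rule: trig_cases)
      case (cosine m' r')
      with i(2) show ?thesis unfolding i(1) cosine(1) cos_cos by auto
    next
      case (sine m')
      with i(2) have "i \<noteq> j" by auto presburger
      then show ?thesis unfolding i(1) sine(1) by (subst inner01_commute) (simp add: sin_cos)
    qed
  next
    case i: (sine m)
    from assms(2) show ?thesis
    proof (cases j rule: trig_cases)
      case (cosine m' r')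
      with i(2,3) have "i \<noteq> j" by auto presburger
      then show ?thesis unfolding i(1) cosine(1) sin_cos by simp
    next
      case (sine m')
      with i show ?thesis unfolding i(1) sine(1) sin_sin by auto
    qed
  qed
qed


section \<open>The covariance operator as a quadratic form\<close>

context second_order_stationary_regressor
begin

interpretation unit_interval: prob_space lborel01 by (rule prob_space_lborel01)
interpretation pair_sigma_finite M lborel01 ..

lemma coordinate_measurable [measurable]:
  assumes "t \<in> {0..1}"
  shows "(\<lambda>\<omega>. X \<omega> t) \<in> borel_measurable M"
proof -
  have "(\<lambda>\<omega>. (\<omega>, t)) \<in> M \<rightarrow>\<^sub>M M \<Otimes>\<^sub>M lborel01"
    using assms by (intro measurable_Pair) auto
  from measurable_compose[OF this jointly_measurable] show ?thesis by simp
qed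

lemma regressor_square_integrable:
  "integrable (M \<Otimes>\<^sub>M lborel01) (\<lambda>(\<omega>, t). (X \<omega> t)\<^sup>2)"
proof (rule Fubini_integrable)
  note [measurable] = jointly_measurable
  show "(\<lambda>(\<omega>, t). (X \<omega> t)\<^sup>2) \<in> borel_measurable (M \<Otimes>\<^sub>M lborel01)" by measurable
  show "AE \<omega> in M. integrable lborel01 (\<lambda>t. case (\<omega>, t) of (\<omega>, t) \<Rightarrow> (X \<omega> t)\<^sup>2)"
    using in_L2 by (intro AE_I2) (simp add: L2_01_def)
  have "(norm01 (X \<omega>))\<^sup>2 = (\<integral>t. norm ((X \<omega> t)\<^sup>2) \<partial>lborel01)" for \<omega>
    unfolding norm01_def inner01_def
    by (subst real_sqrt_pow2) (auto intro!: integral_nonneg_AE simp: power2_eq_square)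
  then show "integrable M (\<lambda>\<omega>. \<integral>t. norm (case (\<omega>, t) of (\<omega>, t) \<Rightarrow> (X \<omega> t)\<^sup>2) \<partial>lborel01)"
    using second_moment by simp
qed

text \<open>The integrability that justifies exchanging expectation and integration in time. It follows
  from \<open>2 \<bar>A X g\<bar> \<le> A\<^sup>2 g\<^sup>2 + X\<^sup>2\<close>, and it is used with two kinds of weight \<open>A\<close>: the value of \<open>X\<close>
  at a fixed time and a score \<open>\<langle>X, f\<rangle>\<close>.\<close>

lemma weighted_regressor_integrable:
  assumes [measurable]: "A \<in> borel_measurable M" "g \<in> L2_01"
    and A2: "integrable M (\<lambda>\<omega>. (A \<omega>)\<^sup>2)"
  shows "integrable (M \<Otimes>\<^sub>M lborel01) (\<lambda>(\<omega>, t). A \<omega> * X \<omega> t * g t)"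
proof -
  note [measurable] = jointly_measurable
  have [measurable]: "g \<in> borel_measurable lborel01" using assms by (simp add: L2_01_def)
  have "integrable (M \<Otimes>\<^sub>M lborel01) (\<lambda>(\<omega>, t). (A \<omega>)\<^sup>2 * (g t)\<^sup>2)"
  proof (rule Fubini_integrable)
    show "integrable M (\<lambda>\<omega>. \<integral>t. norm (case (\<omega>, t) of (\<omega>, t) \<Rightarrow> (A \<omega>)\<^sup>2 * (g t)\<^sup>2) \<partial>lborel01)"
      using A2 by (simp add: abs_mult)
  qed (use L2_01_square_integrable[OF assms(2)] in auto)
  then have "integrable (M \<Otimes>\<^sub>M lborel01) (\<lambda>z. (A (fst z) * g (snd z))\<^sup>2)"
    by (simp add: case_prod_unfold power_mult_distrib)
  then have "integrable (M \<Otimes>\<^sub>M lborel01) (\<lambda>z. (A (fst z) * g (snd z)) * X (fst z) (snd z))"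
    using regressor_square_integrable
    by (intro integrable_product_of_squares) (measurable, simp_all add: case_prod_unfold)
  then show ?thesis by (simp add: case_prod_unfold mult.commute mult.left_commute)
qed

lemma regressor_projection_measurable [measurable]:
  assumes [measurable]: "g \<in> L2_01"
  shows "(\<lambda>\<omega>. inner01 (X \<omega>) g) \<in> borel_measurable M"
proof -
  note [measurable] = jointly_measurable
  have [measurable]: "g \<in> borel_measurable lborel01" using assms by (simp add: L2_01_def)
  show ?thesis unfolding inner01_def by measurable
qed

text \<open>The \<open>\<sigma>\<close>-algebra on \<open>L\<^sup>2\<close> is generated by the functionals \<open>\<langle>\<cdot>, g\<rangle>\<close>, so measurability of \<open>X\<close>
  reduces to that of its scores, which is part of Fubini's theorem.\<close>

lemma regressor_measurable: "X \<in> M \<rightarrow>\<^sub>M borel_L2"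
  unfolding borel_L2_def
proof (rule measurable_measure_of)
  fix A assume "A \<in> {{f \<in> L2_01. inner01 f g \<in> B} | g B. g \<in> L2_01 \<and> B \<in> sets borel}"
  then obtain g and B :: "real set" where "g \<in> L2_01" "B \<in> sets borel" "A = {f \<in> L2_01. inner01 f g \<in> B}"
    by blast
  moreover then have "X -` A \<inter> space M = (\<lambda>\<omega>. inner01 (X \<omega>) g) -` B \<inter> space M"
    using in_L2 by auto
  ultimately show "X -` A \<inter> space M \<in> sets M"
    using measurable_sets[OF regressor_projection_measurable] by simp
qed (use in_L2 in auto)

lemma regressor_projection_square_integrable:
  assumes "g \<in> L2_01"
  shows "integrable M (\<lambda>\<omega>. (inner01 (X \<omega>) g)\<^sup>2)"
proof (rule Bochner_Integration.integrable_bound)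
  show "integrable M (\<lambda>\<omega>. (norm01 (X \<omega>))\<^sup>2 * inner01 g g)"
    using second_moment by simp
  have "(norm01 f)\<^sup>2 = inner01 f f" "0 \<le> inner01 f f" for f
  proof -
    show "0 \<le> inner01 f f" unfolding inner01_def by (rule integral_nonneg_AE) simp
    then show "(norm01 f)\<^sup>2 = inner01 f f" by (simp add: norm01_def)
  qed
  then show "AE \<omega> in M. norm ((inner01 (X \<omega>) g)\<^sup>2) \<le> norm ((norm01 (X \<omega>))\<^sup>2 * inner01 g g)"
    using inner01_Cauchy_Schwarz[OF in_L2 assms] by (intro AE_I2) simp
qed (use assms in measurable)

lemma integral_weighted_regressor:
  assumes "A \<in> borel_measurable M" "g \<in> L2_01" "integrable M (\<lambda>\<omega>. (A \<omega>)\<^sup>2)"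
  shows "(\<integral>t. expectation (\<lambda>\<omega>. A \<omega> * X \<omega> t) * g t \<partial>lborel01)
    = expectation (\<lambda>\<omega>. A \<omega> * inner01 (X \<omega>) g)"
proof -
  have "(\<integral>t. expectation (\<lambda>\<omega>. A \<omega> * X \<omega> t) * g t \<partial>lborel01)
      = (\<integral>t. expectation (\<lambda>\<omega>. A \<omega> * X \<omega> t * g t) \<partial>lborel01)"
    by simp
  also have "\<dots> = expectation (\<lambda>\<omega>. \<integral>t. A \<omega> * X \<omega> t * g t \<partial>lborel01)"
    by (rule Fubini_integral[OF weighted_regressor_integrable[OF assms]])
  finally show ?thesis by (simp add: inner01_def mult.assoc)
qed

lemma cov_operator_eq_expectation:
  assumes "f \<in> L2_01" "s \<in> {0..1}"
  shows "cov_operator M X f s = expectation (\<lambda>\<omega>. inner01 (X \<omega>) f * X \<omega> s)"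
proof -
  have "cov_operator M X f s = (\<integral>t. expectation (\<lambda>\<omega>. X \<omega> s * X \<omega> t) * f t \<partial>lborel01)"
    unfolding cov_operator_def cov_def using assms
    by (intro Bochner_Integration.integral_cong) (simp_all add: centered mult.commute)
  also have "\<dots> = expectation (\<lambda>\<omega>. X \<omega> s * inner01 (X \<omega>) f)"
    using assms by (intro integral_weighted_regressor second_moment_at) simp_all
  finally show ?thesis by (simp add: mult.commute)
qed

text \<open>The covariance operator represents the covariance form of the scores: applying Fubini once
  for each of the two time integrals moves both inside the expectation.\<close>

lemma inner01_cov_operator:
  assumes "f \<in> L2_01" "g \<in> L2_01"
  shows "inner01 (cov_operator M X f) g = expectation (\<lambda>\<omega>. inner01 (X \<omega>) f * inner01 (X \<omega>) g)"
proof -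
  have "inner01 (cov_operator M X f) g
      = (\<integral>s. expectation (\<lambda>\<omega>. inner01 (X \<omega>) f * X \<omega> s) * g s \<partial>lborel01)"
    unfolding inner01_def[of "cov_operator M X f"]
    by (intro Bochner_Integration.integral_cong) (simp_all add: cov_operator_eq_expectation[OF assms(1)])
  also have "\<dots> = expectation (\<lambda>\<omega>. inner01 (X \<omega>) f * inner01 (X \<omega>) g)"
    using assms by (intro integral_weighted_regressor regressor_projection_square_integrable) simp_all
  finally show ?thesis .
qed

text \<open>Here the eigenvalue equation enters: the covariance of the \<open>j\<close>-th score with any other score
  is read off from \<open>\<langle>T \<psi>\<^sub>j, f\<rangle> = \<lambda>\<^sub>j \<langle>\<psi>\<^sub>j, f\<rangle>\<close>.\<close>

lemma expectation_projection_product: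
  assumes "f \<in> L2_01" "j \<ge> 1"
  shows "expectation (\<lambda>\<omega>. inner01 (X \<omega>) (trig j) * inner01 (X \<omega>) f) = lam j * inner01 f (trig j)"
proof -
  have "expectation (\<lambda>\<omega>. inner01 (X \<omega>) (trig j) * inner01 (X \<omega>) f)
      = inner01 (cov_operator M X (trig j)) f"
    using inner01_cov_operator[OF trig_L2_01 assms(1)] by simp
  also have "\<dots> = (\<integral>s. lam j * (f s * trig j s) \<partial>lborel01)"
    unfolding inner01_def[of "cov_operator M X (trig j)"]
  proof (rule integral_cong_AE)
    show "(\<lambda>s. cov_operator M X (trig j) s * f s) \<in> borel_measurable lborel01"
    proof -
      note [measurable] = jointly_measurable
      have [measurable]: "trig j \<in> borel_measurable lborel01" by (simp add: measurable_lborel01)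
      have "(\<lambda>s. expectation (\<lambda>\<omega>. inner01 (X \<omega>) (trig j) * X \<omega> s) * f s) \<in> borel_measurable lborel01"
        using assms trig_L2_01[of j] by measurable
      then show ?thesis
        by (rule measurable_cong[THEN iffD1, rotated])
           (simp add: cov_operator_eq_expectation[OF trig_L2_01])
    qed
    show "AE s in lborel01. cov_operator M X (trig j) s * f s = lam j * (f s * trig j s)"
      using diagonal[OF assms(2)] by eventually_elim simp
  qed (use assms trig_L2_01[of j] in measurable)
  finally show ?thesis by (simp add: inner01_def)
qed

text \<open>With \<open>g\<close> the projection of \<open>f\<close> onto the chosen basis functions, \<open>E \<langle>X, f - g\<rangle>\<^sup>2 \<ge> 0\<close>;
  expanding the square, both the cross term and the square of \<open>\<langle>X, g\<rangle>\<close> have expectation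
  \<open>\<Sum>\<^bsub>j\<in>J\<^esub> \<lambda>\<^sub>j \<langle>f, \<psi>\<^sub>j\<rangle>\<^sup>2\<close>.\<close>

lemma cov_operator_Bessel:
  assumes f: "f \<in> L2_01" and "finite J" and J: "\<And>j. j \<in> J \<Longrightarrow> j \<ge> 1"
  shows "(\<Sum>j\<in>J. lam j * (inner01 f (trig j))\<^sup>2) \<le> inner01 (cov_operator M X f) f"
proof -
  define a where "a j = inner01 f (trig j)" for j
  define g where "g t = (\<Sum>j\<in>J. a j * trig j t)" for t
  have g: "g \<in> L2_01"
    unfolding g_def[abs_def] by (intro L2_01_sum L2_01_scale trig_L2_01 assms)
  have proj_g: "inner01 h g = (\<Sum>j\<in>J. a j * inner01 h (trig j))" if "h \<in> L2_01" for h
    using inner01_sum[of J "\<lambda>j t. a j * trig j t" h] that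
    by (simp add: g_def[abs_def] L2_01_scale trig_L2_01 inner01_scale inner01_commute[of h])
  have gj: "inner01 g (trig j) = a j" if "j \<in> J" for j
  proof -
    have "inner01 g (trig j) = (\<Sum>i\<in>J. a i * inner01 (trig j) (trig i))"
      by (subst inner01_commute) (rule proj_g[OF trig_L2_01])
    also have "\<dots> = (\<Sum>i\<in>J. if i = j then a i else 0)"
      using that J by (intro sum.cong) (auto simp: trig_orthonormal)
    finally show ?thesis using that \<open>finite J\<close> by simp
  qed
  have int: "integrable M (\<lambda>\<omega>. inner01 (X \<omega>) h * inner01 (X \<omega>) k)" if "h \<in> L2_01" "k \<in> L2_01" for h k
    using that by (intro integrable_product_of_squares regressor_projection_square_integrable) simp_all
  have cross: "expectation (\<lambda>\<omega>. inner01 (X \<omega>) g * inner01 (X \<omega>) h)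
      = (\<Sum>j\<in>J. lam j * (a j * inner01 h (trig j)))" if "h \<in> L2_01" for h
  proof -
    have "expectation (\<lambda>\<omega>. inner01 (X \<omega>) g * inner01 (X \<omega>) h)
        = expectation (\<lambda>\<omega>. \<Sum>j\<in>J. a j * (inner01 (X \<omega>) (trig j) * inner01 (X \<omega>) h))"
      by (intro Bochner_Integration.integral_cong) (auto simp: proj_g[OF in_L2]
        sum_distrib_right mult.assoc)
    also have "\<dots> = (\<Sum>j\<in>J. a j * (lam j * inner01 h (trig j)))"
      using that J by (subst Bochner_Integration.integral_sum)
        (auto intro!: int trig_L2_01 sum.cong simp: expectation_projection_product)
    finally show ?thesis by (simp add: mult.left_commute)
  qed
  have "0 \<le> expectation (\<lambda>\<omega>. (inner01 (X \<omega>) f - inner01 (X \<omega>) g)\<^sup>2)"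
    by (rule integral_nonneg_AE) simp
  also have "\<dots> = expectation (\<lambda>\<omega>. inner01 (X \<omega>) f * inner01 (X \<omega>) f
      - 2 * (inner01 (X \<omega>) g * inner01 (X \<omega>) f) + inner01 (X \<omega>) g * inner01 (X \<omega>) g)"
    by (intro Bochner_Integration.integral_cong) (auto simp: power2_eq_square algebra_simps)
  also have "\<dots> = inner01 (cov_operator M X f) f - 2 * (\<Sum>j\<in>J. lam j * (a j)\<^sup>2) + (\<Sum>j\<in>J. lam j * (a j)\<^sup>2)"
    using f g gj by (simp add: int cross inner01_cov_operator) (simp add: a_def power2_eq_square)
  finally show ?thesis by (simp add: a_def)
qed

end


section \<open>Testing bounds\<close>

text \<open>Both measures are compared on rectangles, where the integral of the product density
  factorizes.\<close>

lemma PiM_density: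
  fixes f :: "'a \<Rightarrow> ennreal"
  assumes "finite I" "sigma_finite_measure R" "sigma_finite_measure (density R f)"
    and [measurable]: "f \<in> borel_measurable R"
  shows "PiM I (\<lambda>_. density R f) = density (PiM I (\<lambda>_. R)) (\<lambda>x. \<Prod>i\<in>I. f (x i))"
proof -
  interpret R: product_sigma_finite "\<lambda>_. R" using assms by (intro product_sigma_finite.intro)
  interpret D: product_sigma_finite "\<lambda>_. density R f" using assms by (intro product_sigma_finite.intro)
  let ?P = "PiM I (\<lambda>_. R)"
  show ?thesis
  proof (rule D.PiM_eqI[symmetric])
    show "finite I" by fact
    show "sets (density ?P (\<lambda>x. \<Prod>i\<in>I. f (x i))) = sets (PiM I (\<lambda>_. density R f))"
      by (simp cong: sets_PiM_cong)
    fix A assume "\<And>i. i \<in> I \<Longrightarrow> A i \<in> sets (density R f)"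
    then have A: "A i \<in> sets R" if "i \<in> I" for i using that by simp
    have "emeasure (density ?P (\<lambda>x. \<Prod>i\<in>I. f (x i))) (Pi\<^sub>E I A)
        = (\<integral>\<^sup>+ x. (\<Prod>i\<in>I. f (x i)) * indicator (Pi\<^sub>E I A) x \<partial>?P)"
      using A \<open>finite I\<close> by (intro emeasure_density sets_PiM_I_finite) auto
    also have "\<dots> = (\<integral>\<^sup>+ x. (\<Prod>i\<in>I. f (x i) * indicator (A i) (x i)) \<partial>?P)"
    proof (rule nn_integral_cong)
      fix x assume "x \<in> space ?P"
      then have "x \<in> Pi\<^sub>E I A \<longleftrightarrow> (\<forall>i\<in>I. x i \<in> A i)"
        by (auto simp: space_PiM PiE_iff)
      then have "indicator (Pi\<^sub>E I A) x = (\<Prod>i\<in>I. indicator (A i) (x i) :: ennreal)"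
        using \<open>finite I\<close> by (cases "x \<in> Pi\<^sub>E I A") (auto simp: indicator_def intro!: prod_zero)
      then show "(\<Prod>i\<in>I. f (x i)) * indicator (Pi\<^sub>E I A) x = (\<Prod>i\<in>I. f (x i) * indicator (A i) (x i))"
        by (simp add: prod.distrib)
    qed
    also have "\<dots> = (\<Prod>i\<in>I. \<integral>\<^sup>+ y. f y * indicator (A i) y \<partial>R)"
      using A \<open>finite I\<close> by (intro R.product_nn_integral_prod) auto
    also have "\<dots> = (\<Prod>i\<in>I. emeasure (density R f) (A i))"
      using A by (intro prod.cong) (auto simp: emeasure_density)
    finally show "emeasure (density ?P (\<lambda>x. \<Prod>i\<in>I. f (x i))) (Pi\<^sub>E I A)
        = (\<Prod>i\<in>I. emeasure (density R f) (A i))" .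
  qed
qed

text \<open>The integral of \<open>sqrt (p q)\<close> is the Hellinger affinity of the densities \<open>p\<close> and \<open>q\<close>. Unlike
  the total variation distance it is multiplicative over independent observations, which is why
  the comparison of samples is carried out with it.\<close>

lemma Hellinger_affinity_product:
  fixes p q :: "'a \<Rightarrow> real"
  assumes "finite I" "sigma_finite_measure R"
    and [measurable]: "p \<in> borel_measurable R" "q \<in> borel_measurable R"
    and nonneg: "\<And>x. 0 \<le> p x" "\<And>x. 0 \<le> q x"
  shows "(\<integral>\<^sup>+ x. ennreal (sqrt ((\<Prod>i\<in>I. p (x i)) * (\<Prod>i\<in>I. q (x i)))) \<partial>PiM I (\<lambda>_. R))
    = (\<integral>\<^sup>+ y. ennreal (sqrt (p y * q y)) \<partial>R) ^ card I"
proof -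
  interpret product_sigma_finite "\<lambda>_. R" using assms by (intro product_sigma_finite.intro)
  have sqrt_prod: "sqrt (prod g I) = (\<Prod>i\<in>I. sqrt (g i))" for g
    using \<open>finite I\<close> by induction (auto simp: real_sqrt_mult)
  have "(\<integral>\<^sup>+ x. ennreal (sqrt ((\<Prod>i\<in>I. p (x i)) * (\<Prod>i\<in>I. q (x i)))) \<partial>PiM I (\<lambda>_. R))
      = (\<integral>\<^sup>+ x. (\<Prod>i\<in>I. ennreal (sqrt (p (x i) * q (x i)))) \<partial>PiM I (\<lambda>_. R))"
    by (simp add: nonneg prod_ennreal sqrt_prod prod.distrib[symmetric])
  also have "\<dots> = (\<Prod>i\<in>I. \<integral>\<^sup>+ y. ennreal (sqrt (p y * q y)) \<partial>R)"
    using \<open>finite I\<close> by (intro product_nn_integral_prod) auto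
  finally show ?thesis by simp
qed

text \<open>An estimate \<open>u\<close> cannot be close to both \<open>b\<close> and \<open>-b\<close>, and where \<open>sqrt (p q)\<close> is large both
  errors are charged. Quantitatively, \<open>2 b \<le> \<bar>u - b\<bar> + \<bar>u + b\<bar>\<close> is multiplied by \<open>sqrt (p q)\<close> and
  each term is split by the inequality of arithmetic and geometric means with weight \<open>s\<close>.
  Integration gives \<open>4 s b r \<le> risk + 2 s\<^sup>2\<close>, which is best at \<open>s = b r\<close>.\<close>

lemma two_point_quadratic_risk:
  fixes p q u :: "'a \<Rightarrow> real"
  assumes [measurable]: "p \<in> borel_measurable R" "q \<in> borel_measurable R" "u \<in> borel_measurable R"
    and nonneg: "\<And>x. 0 \<le> p x" "\<And>x. 0 \<le> q x"
    and mass: "(\<integral>\<^sup>+ x. ennreal (p x) \<partial>R) \<le> 1" "(\<integral>\<^sup>+ x. ennreal (q x) \<partial>R) \<le> 1"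
    and affinity: "ennreal r \<le> (\<integral>\<^sup>+ x. ennreal (sqrt (p x * q x)) \<partial>R)"
    and "0 \<le> b" "0 \<le> r"
  shows "ennreal (2 * b\<^sup>2 * r\<^sup>2) \<le>
    (\<integral>\<^sup>+ x. ennreal ((u x - b)\<^sup>2) \<partial>density R p) + (\<integral>\<^sup>+ x. ennreal ((u x + b)\<^sup>2) \<partial>density R q)"
    (is "_ \<le> ?risk")
proof -
  define s where "s = b * r"
  have "0 \<le> s" using \<open>0 \<le> b\<close> \<open>0 \<le> r\<close> by (simp add: s_def)
  have pointwise: "4 * s * b * sqrt (p x * q x)
      \<le> (p x * (u x - b)\<^sup>2 + q x * (u x + b)\<^sup>2) + s\<^sup>2 * (p x + q x)" for x
  proof -
    define P Q where "P = sqrt (p x)" and "Q = sqrt (q x)"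
    have PQ: "p x = P\<^sup>2" "q x = Q\<^sup>2" "0 \<le> P" "0 \<le> Q" by (simp_all add: P_def Q_def nonneg)
    have "2 * b \<le> \<bar>u x - b\<bar> + \<bar>u x + b\<bar>" by linarith
    then have "2 * s * P * Q * (2 * b) \<le> 2 * s * P * Q * (\<bar>u x - b\<bar> + \<bar>u x + b\<bar>)"
      using PQ \<open>0 \<le> s\<close> by (intro mult_left_mono) auto
    also have "\<dots> = 2 * (\<bar>u x - b\<bar> * P) * (s * Q) + 2 * (\<bar>u x + b\<bar> * Q) * (s * P)"
      by (simp add: algebra_simps)
    also have "\<dots> \<le> ((\<bar>u x - b\<bar> * P)\<^sup>2 + (s * Q)\<^sup>2) + ((\<bar>u x + b\<bar> * Q)\<^sup>2 + (s * P)\<^sup>2)"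
      by (intro add_mono sum_squares_bound)
    finally show ?thesis
      using PQ by (simp add: real_sqrt_mult power_mult_distrib algebra_simps)
  qed
  have "ennreal (4 * s * b) * ennreal r \<le> ennreal (4 * s * b) * (\<integral>\<^sup>+ x. ennreal (sqrt (p x * q x)) \<partial>R)"
    by (intro mult_left_mono affinity) simp
  also have "\<dots> = (\<integral>\<^sup>+ x. ennreal (4 * s * b * sqrt (p x * q x)) \<partial>R)"
    using \<open>0 \<le> b\<close> \<open>0 \<le> s\<close> nonneg by (simp add: ennreal_mult nn_integral_cmult)
  also have "\<dots> \<le> (\<integral>\<^sup>+ x. (ennreal (p x) * ennreal ((u x - b)\<^sup>2) + ennreal (q x) * ennreal ((u x + b)\<^sup>2))
      + ennreal (s\<^sup>2) * (ennreal (p x) + ennreal (q x)) \<partial>R)"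
  proof (rule nn_integral_mono)
    fix x
    have "ennreal (4 * s * b * sqrt (p x * q x))
        \<le> ennreal ((p x * (u x - b)\<^sup>2 + q x * (u x + b)\<^sup>2) + s\<^sup>2 * (p x + q x))"
      by (rule ennreal_leI[OF pointwise])
    also have "\<dots> = (ennreal (p x) * ennreal ((u x - b)\<^sup>2) + ennreal (q x) * ennreal ((u x + b)\<^sup>2))
      + ennreal (s\<^sup>2) * (ennreal (p x) + ennreal (q x))"
      using nonneg by (simp add: ennreal_plus ennreal_mult)
    finally show "ennreal (4 * s * b * sqrt (p x * q x)) \<le> \<dots>" .
  qed
  also have "\<dots> = ?risk + ennreal (s\<^sup>2) * ((\<integral>\<^sup>+ x. ennreal (p x) \<partial>R) + (\<integral>\<^sup>+ x. ennreal (q x) \<partial>R))"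
    by (simp add: nn_integral_density nn_integral_add nn_integral_cmult)
  also have "\<dots> \<le> ?risk + ennreal (s\<^sup>2) * (1 + 1)"
    using mass by (intro add_mono mult_left_mono) auto
  finally have "ennreal (2 * s\<^sup>2 + 2 * s\<^sup>2) \<le> ?risk + ennreal (2 * s\<^sup>2)"
    using \<open>0 \<le> b\<close> \<open>0 \<le> r\<close> \<open>0 \<le> s\<close>
    by (simp add: ennreal_mult[symmetric] s_def power2_eq_square algebra_simps flip: ennreal_numeral)
  then have "ennreal (2 * s\<^sup>2) + ennreal (2 * s\<^sup>2) \<le> ?risk + ennreal (2 * s\<^sup>2)"
    by (subst (asm) ennreal_plus) auto
  then have "ennreal (2 * s\<^sup>2) \<le> ?risk"
    by (subst (asm) (1 2) add.commute) (simp add: ennreal_add_left_cancel_le)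
  then show ?thesis by (simp add: s_def power_mult_distrib mult.assoc)
qed

text \<open>A set \<open>S\<close> encodes the vertex of the hypercube whose positive signs are the elements of \<open>S\<close>.
  The vertices are paired along each coordinate \<open>j\<close>: every \<open>S\<close> without \<open>j\<close> is matched with
  \<open>insert j S\<close>, so that summation over all vertices collects \<open>K\<close> from each edge of the cube.\<close>

lemma Assouad_averaging:
  fixes f :: "'a set \<Rightarrow> 'a \<Rightarrow> ennreal"
  assumes "finite J"
    and pair: "\<And>j S. j \<in> J \<Longrightarrow> S \<subseteq> J - {j} \<Longrightarrow> K \<le> f S j + f (insert j S) j"
    and bound: "\<And>S. S \<subseteq> J \<Longrightarrow> (\<Sum>j\<in>J. f S j) \<le> V"
  shows "of_nat (card J) * K \<le> 2 * V"
proof (cases "J = {}")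
  case False
  define N where "N = card J - 1"
  have card: "card J = Suc N"
    using False \<open>finite J\<close> by (simp add: N_def card_gt_0_iff)
  have split: "(\<Sum>S\<in>Pow J. g S) = (\<Sum>S\<in>Pow (J - {j}). g S + g (insert j S))"
    if "j \<in> J" for j and g :: "'a set \<Rightarrow> ennreal"
  proof -
    have J: "J = insert j (J - {j})" using that by auto
    have "(\<Sum>S\<in>Pow J. g S) = (\<Sum>S\<in>Pow (J - {j}) \<union> insert j ` Pow (J - {j}). g S)"
      by (subst J) (simp only: Pow_insert)
    also have "\<dots> = (\<Sum>S\<in>Pow (J - {j}). g S) + (\<Sum>S\<in>insert j ` Pow (J - {j}). g S)"
      using \<open>finite J\<close> by (intro sum.union_disjoint) auto
    also have "(\<Sum>S\<in>insert j ` Pow (J - {j}). g S) = (\<Sum>S\<in>Pow (J - {j}). g (insert j S))"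
      by (subst sum.reindex) (auto simp: inj_on_def)
    finally show ?thesis by (simp add: sum.distrib)
  qed
  have "2 ^ N * (of_nat (card J) * K) = (\<Sum>j\<in>J. \<Sum>S\<in>Pow (J - {j}). K)"
    using \<open>finite J\<close> card by (simp add: card_Pow mult.left_commute)
  also have "\<dots> \<le> (\<Sum>j\<in>J. \<Sum>S\<in>Pow (J - {j}). f S j + f (insert j S) j)"
    by (intro sum_mono pair) auto
  also have "\<dots> = (\<Sum>j\<in>J. \<Sum>S\<in>Pow J. f S j)"
    by (intro sum.cong refl split[symmetric])
  also have "\<dots> = (\<Sum>S\<in>Pow J. \<Sum>j\<in>J. f S j)"
    by (rule sum.swap)
  also have "\<dots> \<le> (\<Sum>S\<in>Pow J. V)"
    by (intro sum_mono bound) auto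
  also have "\<dots> = 2 ^ N * (2 * V)"
    using \<open>finite J\<close> card by (simp add: card_Pow mult.assoc mult.left_commute)
  finally show ?thesis
    by (subst (asm) ennreal_mult_le_mult_iff) (auto simp: power_eq_top_ennreal)
qed simp


section \<open>The law of the sample\<close>

text \<open>Completing the square: the geometric mean of two normal densities of equal variance is a
  multiple of the normal density at the midpoint.\<close>

lemma sqrt_normal_density_product:
  assumes "\<sigma> > 0"
  shows "sqrt (normal_density \<mu> \<sigma> y * normal_density \<nu> \<sigma> y)
    = exp (- (\<mu> - \<nu>)\<^sup>2 / (8 * \<sigma>\<^sup>2)) * normal_density ((\<mu> + \<nu>) / 2) \<sigma> y"
proof (rule real_sqrt_unique)
  have "- (y - \<mu>)\<^sup>2 / (2 * \<sigma>\<^sup>2) + - (y - \<nu>)\<^sup>2 / (2 * \<sigma>\<^sup>2)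
      = 2 * (- (\<mu> - \<nu>)\<^sup>2 / (8 * \<sigma>\<^sup>2) + - (y - (\<mu> + \<nu>) / 2)\<^sup>2 / (2 * \<sigma>\<^sup>2))"
    using assms by (simp add: field_simps power2_eq_square)
  then have "exp (- (y - \<mu>)\<^sup>2 / (2 * \<sigma>\<^sup>2)) * exp (- (y - \<nu>)\<^sup>2 / (2 * \<sigma>\<^sup>2))
      = (exp (- (\<mu> - \<nu>)\<^sup>2 / (8 * \<sigma>\<^sup>2)) * exp (- (y - (\<mu> + \<nu>) / 2)\<^sup>2 / (2 * \<sigma>\<^sup>2)))\<^sup>2"
    by (simp only: exp_add[symmetric] exp_double)
  then show "(exp (- (\<mu> - \<nu>)\<^sup>2 / (8 * \<sigma>\<^sup>2)) * normal_density ((\<mu> + \<nu>) / 2) \<sigma> y)\<^sup>2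
      = normal_density \<mu> \<sigma> y * normal_density \<nu> \<sigma> y"
    by (simp add: normal_density_def power_mult_distrib power_divide power2_eq_square)
qed simp

lemma nn_integral_normal_density:
  assumes "\<sigma> > 0"
  shows "(\<integral>\<^sup>+ y. ennreal (normal_density \<mu> \<sigma> y) \<partial>lborel) = 1"
  using prob_space.emeasure_space_1[OF prob_space_normal_density[OF assms]]
  by (simp add: emeasure_density)

locale functional_linear_model = second_order_stationary_regressor M X c lam
  for M :: "'w measure" and X c lam +
  fixes \<epsilon> :: "'w \<Rightarrow> real" and \<sigma> :: real
  assumes error: "standard_normal_indep_error M X \<epsilon>"
    and sigma_pos: "\<sigma> > 0"
begin

definition regressor_law :: "(real \<Rightarrow> real) measure" where
  "regressor_law = distr M borel_L2 X"

text \<open>The density of \<open>(Y, X)\<close> relative to the product of Lebesgue measure with the law of the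
  regressor; it is therefore the conditional normal density of the response alone.\<close>

definition observation_density :: "(real \<Rightarrow> real) \<Rightarrow> real \<times> (real \<Rightarrow> real) \<Rightarrow> real" where
  "observation_density \<beta> z = normal_density (inner01 \<beta> (snd z)) \<sigma> (fst z)"

lemma prob_space_regressor_law: "prob_space regressor_law"
  unfolding regressor_law_def by (rule prob_space_distr) (rule regressor_measurable)

lemma sets_regressor_law [measurable_cong, simp]: "sets regressor_law = sets borel_L2"
  by (simp add: regressor_law_def)

sublocale law: pair_sigma_finite lborel regressor_law
  by (intro pair_sigma_finite.intro sigma_finite_lborel prob_space_imp_sigma_finite
      prob_space_regressor_law)

lemma error_measurable [measurable]: "\<epsilon> \<in> borel_measurable M"
  using error by (auto simp: standard_normal_indep_error_def distributed_def)

lemma projection_measurable [measurable]: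
  "\<beta> \<in> L2_01 \<Longrightarrow> (\<lambda>x. inner01 \<beta> x) \<in> borel_measurable borel_L2"
  using inner01_measurable_borel_L2[of \<beta>] by (simp add: inner01_commute)

lemma observation_density_measurable [measurable]:
  assumes "\<beta> \<in> L2_01"
  shows "observation_density \<beta> \<in> borel_measurable (lborel \<Otimes>\<^sub>M regressor_law)"
proof -
  note [measurable] = projection_measurable[OF assms]
  show ?thesis unfolding observation_density_def normal_density_def by measurable
qed

lemma observation_density_nonneg: "0 \<le> observation_density \<beta> z"
  by (simp add: observation_density_def)

text \<open>Independence is given for the generated \<open>\<sigma>\<close>-algebras, so the joint law is identified with
  the product measure on rectangles.\<close>

lemma error_regressor_law:
  "distr M (borel \<Otimes>\<^sub>M borel_L2) (\<lambda>\<omega>. (\<epsilon> \<omega>, X \<omega>))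
    = density lborel std_normal_density \<Otimes>\<^sub>M regressor_law"
proof (rule pair_measure_eqI[symmetric])
  note [measurable] = regressor_measurable
  have distr_error: "distr M lborel \<epsilon> = density lborel std_normal_density"
    using error by (simp add: standard_normal_indep_error_def distributed_def)
  show "sigma_finite_measure (density lborel std_normal_density)"
    by (intro prob_space_imp_sigma_finite prob_space_normal_density) simp
  show "sigma_finite_measure regressor_law" ..
  show "sets (density lborel std_normal_density \<Otimes>\<^sub>M regressor_law)
      = sets (distr M (borel \<Otimes>\<^sub>M borel_L2) (\<lambda>\<omega>. (\<epsilon> \<omega>, X \<omega>)))"
    by (simp cong: sets_pair_measure_cong)
  fix A B assume A: "A \<in> sets (density lborel std_normal_density)" and B: "B \<in> sets regressor_law"
  then have [measurable]: "A \<in> sets borel" "B \<in> sets borel_L2" by simp_all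
  let ?EA = "\<epsilon> -` A \<inter> space M" and ?EB = "X -` B \<inter> space M"
  have "prob (?EA \<inter> ?EB) = prob ?EA * prob ?EB"
  proof (rule indep_setD)
    show "indep_set (sets (vimage_algebra (space M) \<epsilon> borel)) (sets (vimage_algebra (space M) X borel_L2))"
      using error by (simp add: standard_normal_indep_error_def)
  qed (auto intro!: in_vimage_algebra)
  then have "emeasure M (?EA \<inter> ?EB) = emeasure M ?EA * emeasure M ?EB"
    by (simp add: emeasure_eq_measure ennreal_mult)
  moreover have "(\<lambda>\<omega>. (\<epsilon> \<omega>, X \<omega>)) -` (A \<times> B) \<inter> space M = ?EA \<inter> ?EB" by auto
  ultimately show "emeasure (density lborel std_normal_density) A * emeasure regressor_law B
      = emeasure (distr M (borel \<Otimes>\<^sub>M borel_L2) (\<lambda>\<omega>. (\<epsilon> \<omega>, X \<omega>))) (A \<times> B)"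
    by (simp add: distr_error[symmetric] regressor_law_def emeasure_distr)
qed

text \<open>Given \<open>X = x\<close> the response is an affine image of the standard normal error, and the
  substitution \<open>y = \<langle>\<beta>, x\<rangle> + \<sigma> e\<close> turns its law into a normal density. The dominating measure is
  common to all slopes, which makes the affinities between different slopes computable.\<close>

lemma observation_law_eq_density:
  assumes [measurable]: "\<beta> \<in> L2_01"
  shows "observation_law M X \<epsilon> \<sigma> \<beta>
    = density (lborel \<Otimes>\<^sub>M regressor_law) (observation_density \<beta>)"
proof (rule measure_eqI)
  note [measurable] = regressor_measurable projection_measurable[OF assms]
  let ?G = "density lborel std_normal_density"
  interpret G: prob_space ?G by (rule prob_space_normal_density) simp
  interpret GN: pair_sigma_finite ?G regressor_law ..
  show "sets (observation_law M X \<epsilon> \<sigma> \<beta>)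
      = sets (density (lborel \<Otimes>\<^sub>M regressor_law) (observation_density \<beta>))"
    by (simp add: observation_law_def cong: sets_pair_measure_cong)
  fix A assume "A \<in> sets (observation_law M X \<epsilon> \<sigma> \<beta>)"
  then have A [measurable]: "A \<in> sets (borel \<Otimes>\<^sub>M borel_L2)" by (simp add: observation_law_def)
  let ?h = "\<lambda>(e, x). (inner01 \<beta> x + \<sigma> * e, x)"
  have h [measurable]: "?h \<in> borel \<Otimes>\<^sub>M borel_L2 \<rightarrow>\<^sub>M borel \<Otimes>\<^sub>M borel_L2" by measurable
  have "observation_law M X \<epsilon> \<sigma> \<beta>
      = distr (distr M (borel \<Otimes>\<^sub>M borel_L2) (\<lambda>\<omega>. (\<epsilon> \<omega>, X \<omega>))) (borel \<Otimes>\<^sub>M borel_L2) ?h"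
    by (subst distr_distr) (auto simp: observation_law_def comp_def)
  also have "\<dots> = distr (?G \<Otimes>\<^sub>M regressor_law) (borel \<Otimes>\<^sub>M borel_L2) ?h"
    by (simp only: error_regressor_law)
  finally have "emeasure (observation_law M X \<epsilon> \<sigma> \<beta>) A
      = (\<integral>\<^sup>+ z. indicator A z \<partial>distr (?G \<Otimes>\<^sub>M regressor_law) (borel \<Otimes>\<^sub>M borel_L2) ?h)"
    by (simp add: nn_integral_indicator)
  also have "\<dots> = (\<integral>\<^sup>+ z. indicator A (?h z) \<partial>(?G \<Otimes>\<^sub>M regressor_law))"
    by (intro nn_integral_distr) measurable
  also have "\<dots> = (\<integral>\<^sup>+ x. \<integral>\<^sup>+ e. indicator A (inner01 \<beta> x + \<sigma> * e, x) \<partial>?G \<partial>regressor_law)"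
    by (subst GN.nn_integral_snd[symmetric]) auto
  also have "\<dots> = (\<integral>\<^sup>+ x. \<integral>\<^sup>+ y. ennreal (observation_density \<beta> (y, x)) * indicator A (y, x)
        \<partial>lborel \<partial>regressor_law)"
  proof (rule nn_integral_cong)
    fix x assume "x \<in> space regressor_law"
    then have x [measurable]: "x \<in> space borel_L2" by (simp add: regressor_law_def)
    have [measurable]: "(\<lambda>y. indicator A (y, x) :: ennreal) \<in> borel_measurable borel"
      using x by measurable
    have "(\<integral>\<^sup>+ y. ennreal (observation_density \<beta> (y, x)) * indicator A (y, x) \<partial>lborel)
        = ennreal \<bar>\<sigma>\<bar> * (\<integral>\<^sup>+ e. ennreal (observation_density \<beta> (inner01 \<beta> x + \<sigma> * e, x))
            * indicator A (inner01 \<beta> x + \<sigma> * e, x) \<partial>lborel)"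
      using sigma_pos by (intro nn_integral_real_affine) (auto simp: observation_density_def)
    also have "\<dots> = (\<integral>\<^sup>+ e. ennreal \<bar>\<sigma>\<bar> * (ennreal (observation_density \<beta> (inner01 \<beta> x + \<sigma> * e, x))
            * indicator A (inner01 \<beta> x + \<sigma> * e, x)) \<partial>lborel)"
      by (rule nn_integral_cmult[symmetric]) (simp add: observation_density_def)
    also have "\<dots> = (\<integral>\<^sup>+ e. ennreal (std_normal_density e) * indicator A (inner01 \<beta> x + \<sigma> * e, x) \<partial>lborel)"
    proof (rule nn_integral_cong)
      fix e
      have "\<bar>\<sigma>\<bar> * observation_density \<beta> (inner01 \<beta> x + \<sigma> * e, x) = std_normal_density e"
        using sigma_pos
        by (simp add: observation_density_def normal_density_def real_sqrt_mult power_mult_distrib)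
      then show "ennreal \<bar>\<sigma>\<bar> * (ennreal (observation_density \<beta> (inner01 \<beta> x + \<sigma> * e, x))
            * indicator A (inner01 \<beta> x + \<sigma> * e, x))
          = ennreal (std_normal_density e) * indicator A (inner01 \<beta> x + \<sigma> * e, x)"
        by (simp add: mult.assoc[symmetric] ennreal_mult[symmetric] observation_density_nonneg)
    qed
    also have "\<dots> = (\<integral>\<^sup>+ e. indicator A (inner01 \<beta> x + \<sigma> * e, x) \<partial>?G)"
      by (subst nn_integral_density) auto
    finally show "(\<integral>\<^sup>+ e. indicator A (inner01 \<beta> x + \<sigma> * e, x) \<partial>?G)
        = (\<integral>\<^sup>+ y. ennreal (observation_density \<beta> (y, x)) * indicator A (y, x) \<partial>lborel)" ..
  qed
  also have "\<dots> = (\<integral>\<^sup>+ z. ennreal (observation_density \<beta> z) * indicator A z \<partial>(lborel \<Otimes>\<^sub>M regressor_law))"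
    by (subst law.nn_integral_snd[symmetric]) auto
  also have "\<dots> = emeasure (density (lborel \<Otimes>\<^sub>M regressor_law) (observation_density \<beta>)) A"
    by (subst emeasure_density) auto
  finally show "emeasure (observation_law M X \<epsilon> \<sigma> \<beta>) A
      = emeasure (density (lborel \<Otimes>\<^sub>M regressor_law) (observation_density \<beta>)) A" .
qed

lemma prob_space_observation_law:
  assumes [measurable]: "\<beta> \<in> L2_01"
  shows "prob_space (observation_law M X \<epsilon> \<sigma> \<beta>)"
proof -
  note [measurable] = regressor_measurable projection_measurable[OF assms]
  show ?thesis unfolding observation_law_def by (rule prob_space_distr) measurable
qed

lemma sample_law_eq_density:
  assumes "\<beta> \<in> L2_01"
  shows "sample_law M X \<epsilon> \<sigma> n \<beta> = density (PiM {..<n} (\<lambda>_. lborel \<Otimes>\<^sub>M regressor_law))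
    (\<lambda>D. ennreal (\<Prod>i<n. observation_density \<beta> (D i)))"
proof -
  have "sigma_finite_measure (density (lborel \<Otimes>\<^sub>M regressor_law) (observation_density \<beta>))"
    using prob_space_observation_law[OF assms]
    by (simp add: observation_law_eq_density[OF assms] prob_space_imp_sigma_finite)
  then show ?thesis
    unfolding sample_law_def observation_law_eq_density[OF assms]
    using observation_density_measurable[OF assms]
    by (subst PiM_density) (auto simp: law.sigma_finite_measure_axioms
        prod_ennreal observation_density_nonneg)
qed

text \<open>Integrating out the response leaves \<open>exp (- \<langle>x, \<beta> - \<beta>'\<rangle>\<^sup>2 / (8 \<sigma>\<^sup>2))\<close>, to which
  \<open>exp z \<ge> 1 + z\<close> is applied before taking the expectation over the regressor.\<close>

lemma observation_affinity:
  assumes [measurable]: "\<beta> \<in> L2_01" "\<beta>' \<in> L2_01"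
  shows "ennreal (1 - expectation (\<lambda>\<omega>. (inner01 (X \<omega>) (\<lambda>t. \<beta> t - \<beta>' t))\<^sup>2) / (8 * \<sigma>\<^sup>2))
    \<le> (\<integral>\<^sup>+ z. ennreal (sqrt (observation_density \<beta> z * observation_density \<beta>' z))
        \<partial>(lborel \<Otimes>\<^sub>M regressor_law))"
proof -
  note [measurable] = regressor_measurable projection_measurable[OF assms(1)]
    projection_measurable[OF assms(2)]
    observation_density_measurable[OF assms(1)] observation_density_measurable[OF assms(2)]
  have diff: "(\<lambda>t. \<beta> t - \<beta>' t) \<in> L2_01" using assms by (rule L2_01_diff)
  let ?D = "\<lambda>\<omega>. inner01 (X \<omega>) (\<lambda>t. \<beta> t - \<beta>' t)"
  have D: "inner01 \<beta> (X \<omega>) - inner01 \<beta>' (X \<omega>) = ?D \<omega>" if "\<omega> \<in> space M" for \<omega>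
    using inner01_diff[OF assms in_L2[OF that]] by (simp add: inner01_commute)
  have [measurable]: "?D \<in> borel_measurable M" by (rule regressor_projection_measurable[OF diff])
  have int: "integrable M (\<lambda>\<omega>. (?D \<omega>)\<^sup>2)" by (rule regressor_projection_square_integrable[OF diff])
  have int_exp: "integrable M (\<lambda>\<omega>. exp (- (?D \<omega>)\<^sup>2 / (8 * \<sigma>\<^sup>2)))"
    by (intro integrable_const_bound[of _ 1]) auto
  have "1 - expectation (\<lambda>\<omega>. (?D \<omega>)\<^sup>2) / (8 * \<sigma>\<^sup>2) = expectation (\<lambda>\<omega>. 1 - (?D \<omega>)\<^sup>2 / (8 * \<sigma>\<^sup>2))"
    using int by (simp add: prob_space)
  also have "\<dots> \<le> expectation (\<lambda>\<omega>. exp (- (?D \<omega>)\<^sup>2 / (8 * \<sigma>\<^sup>2)))"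
    using int int_exp exp_ge_add_one_self[of "- (?D _)\<^sup>2 / (8 * \<sigma>\<^sup>2)"]
    by (intro integral_mono) auto
  finally have "ennreal (1 - expectation (\<lambda>\<omega>. (?D \<omega>)\<^sup>2) / (8 * \<sigma>\<^sup>2))
      \<le> (\<integral>\<^sup>+ \<omega>. ennreal (exp (- (?D \<omega>)\<^sup>2 / (8 * \<sigma>\<^sup>2))) \<partial>M)"
    by (subst nn_integral_eq_integral[OF int_exp]) (auto intro: ennreal_leI)
  also have "\<dots> = (\<integral>\<^sup>+ \<omega>. ennreal (exp (- (inner01 \<beta> (X \<omega>) - inner01 \<beta>' (X \<omega>))\<^sup>2 / (8 * \<sigma>\<^sup>2))) \<partial>M)"
    by (intro nn_integral_cong) (simp add: D)
  also have "\<dots> = (\<integral>\<^sup>+ x. ennreal (exp (- (inner01 \<beta> x - inner01 \<beta>' x)\<^sup>2 / (8 * \<sigma>\<^sup>2))) \<partial>regressor_law)"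
    unfolding regressor_law_def by (subst nn_integral_distr) auto
  also have "\<dots> = (\<integral>\<^sup>+ x. \<integral>\<^sup>+ y. ennreal (sqrt (observation_density \<beta> (y, x) * observation_density \<beta>' (y, x)))
        \<partial>lborel \<partial>regressor_law)"
    using sigma_pos
    by (simp add: observation_density_def sqrt_normal_density_product ennreal_mult nn_integral_cmult
        nn_integral_normal_density)
  also have "\<dots> = (\<integral>\<^sup>+ z. ennreal (sqrt (observation_density \<beta> z * observation_density \<beta>' z))
        \<partial>(lborel \<Otimes>\<^sub>M regressor_law))"
    by (subst law.nn_integral_snd[symmetric]) auto
  finally show ?thesis .
qed

text \<open>The affinity of the sample is the \<open>n\<close>-th power of the affinity of one observation. If \<open>\<delta>\<close>
  bounds the defect of the latter and \<open>n \<delta> \<le> 1 / 2\<close>, Bernoulli's inequality gives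
  \<open>(1 - \<delta>)\<^sup>n \<ge> 1 / 2\<close>.\<close>

lemma sample_affinity:
  assumes "\<beta> \<in> L2_01" "\<beta>' \<in> L2_01"
    and small: "real n * expectation (\<lambda>\<omega>. (inner01 (X \<omega>) (\<lambda>t. \<beta> t - \<beta>' t))\<^sup>2) \<le> 4 * \<sigma>\<^sup>2"
  shows "ennreal (1 / 2) \<le> (\<integral>\<^sup>+ D. ennreal (sqrt ((\<Prod>i<n. observation_density \<beta> (D i))
      * (\<Prod>i<n. observation_density \<beta>' (D i)))) \<partial>PiM {..<n} (\<lambda>_. lborel \<Otimes>\<^sub>M regressor_law))"
proof (cases "n = 0")
  case True
  have "ennreal (1 / 2) \<le> ennreal 1" by (rule ennreal_leI) simp
  then show ?thesis using True by (simp add: PiM_empty nn_integral_count_space_finite)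
next
  case False
  define \<delta> where "\<delta> = expectation (\<lambda>\<omega>. (inner01 (X \<omega>) (\<lambda>t. \<beta> t - \<beta>' t))\<^sup>2) / (8 * \<sigma>\<^sup>2)"
  have "0 \<le> \<delta>" unfolding \<delta>_def by (simp add: integral_nonneg_AE)
  have n\<delta>: "real n * \<delta> \<le> 1 / 2"
    using small sigma_pos by (simp add: \<delta>_def field_simps)
  moreover have "\<delta> \<le> real n * \<delta>"
    using False \<open>0 \<le> \<delta>\<close> by (intro mult_le_cancel_right1[THEN iffD2]) auto
  ultimately have "\<delta> \<le> 1" by linarith
  have "1 / 2 \<le> 1 + real n * (- \<delta>)" using n\<delta> by simp
  also have "\<dots> \<le> (1 + (- \<delta>)) ^ n"
    using \<open>\<delta> \<le> 1\<close> by (intro Bernoulli_inequality) simp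
  finally have "1 / 2 \<le> (1 - \<delta>) ^ n" by simp
  then have "ennreal (1 / 2) \<le> ennreal ((1 - \<delta>) ^ n)" by (rule ennreal_leI)
  also have "\<dots> = ennreal (1 - \<delta>) ^ n" using \<open>\<delta> \<le> 1\<close> by (simp add: ennreal_power)
  also have "\<dots> \<le> (\<integral>\<^sup>+ z. ennreal (sqrt (observation_density \<beta> z * observation_density \<beta>' z))
        \<partial>(lborel \<Otimes>\<^sub>M regressor_law)) ^ n"
    unfolding \<delta>_def by (intro power_mono observation_affinity assms) simp
  also have "\<dots> = (\<integral>\<^sup>+ D. ennreal (sqrt ((\<Prod>i<n. observation_density \<beta> (D i))
      * (\<Prod>i<n. observation_density \<beta>' (D i)))) \<partial>PiM {..<n} (\<lambda>_. lborel \<Otimes>\<^sub>M regressor_law))"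
    using assms
    by (subst Hellinger_affinity_product)
       (auto simp: law.sigma_finite_measure_axioms observation_density_nonneg
         observation_density_measurable)
  finally show ?thesis .
qed

end


section \<open>The hypercube of slopes\<close>

definition hypercube_slope :: "nat \<Rightarrow> (nat \<Rightarrow> real) \<Rightarrow> nat set \<Rightarrow> real \<Rightarrow> real" where
  "hypercube_slope m b S t = (\<Sum>j=1..m. (if j \<in> S then b j else - b j) * trig j t)"

lemma hypercube_slope_L2_01: "hypercube_slope m b S \<in> L2_01"
  unfolding hypercube_slope_def[abs_def] by (intro L2_01_sum L2_01_scale trig_L2_01) simp

lemma inner01_hypercube_slope:
  assumes "j \<ge> 1"
  shows "inner01 (hypercube_slope m b S) (trig j) = (if j \<le> m then if j \<in> S then b j else - b j else 0)"
proof -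
  have "inner01 (hypercube_slope m b S) (trig j)
      = (\<Sum>i=1..m. (if i \<in> S then b i else - b i) * inner01 (trig i) (trig j))"
    unfolding hypercube_slope_def[abs_def] inner01_scale[symmetric]
    by (intro inner01_sum L2_01_scale trig_L2_01)
  also have "\<dots> = (\<Sum>i=1..m. if i = j then if j \<in> S then b j else - b j else 0)"
    using assms by (intro sum.cong) (auto simp: trig_orthonormal)
  finally show ?thesis using assms by simp
qed

lemma hypercube_slope_in_ellipsoid:
  assumes "(\<Sum>j=1..m. sobolev_weight p j * (b j)\<^sup>2) \<le> \<rho>"
  shows "hypercube_slope m b S \<in> sobolev_ellipsoid p \<rho>"
proof -
  let ?g = "\<lambda>j. sobolev_weight p j * \<bar>inner01 (hypercube_slope m b S) (trig j)\<bar>\<^sup>2"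
  have g_tail: "inner01 (hypercube_slope m b S) (trig j) = 0" if "j > m" for j
    using that by (simp add: inner01_hypercube_slope)
  have summable: "?g summable_on {1..} \<longleftrightarrow> ?g summable_on {1..m}"
    by (rule summable_on_cong_neutral) (auto simp: g_tail)
  have "(\<Sum>\<^sub>\<infinity>j\<in>{1..}. ?g j) = (\<Sum>\<^sub>\<infinity>j\<in>{1..m}. ?g j)"
    by (rule infsum_cong_neutral) (auto simp: g_tail)
  also have "\<dots> = (\<Sum>j=1..m. sobolev_weight p j * (b j)\<^sup>2)"
    by (subst infsum_finite) (auto intro!: sum.cong simp: inner01_hypercube_slope)
  finally show ?thesis
    using assms summable by (simp add: sobolev_ellipsoid_def hypercube_slope_L2_01)
qed

text \<open>Neighbouring vertices of the hypercube differ by a multiple of one eigenfunction, so the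
  second moment of the corresponding score is \<open>4 b\<^sub>j\<^sup>2 \<lambda>\<^sub>j\<close>.\<close>

lemma hypercube_slope_insert_diff:
  assumes "j \<notin> S" "1 \<le> j" "j \<le> m"
  shows "hypercube_slope m b (insert j S) t - hypercube_slope m b S t = 2 * b j * trig j t"
proof -
  have "hypercube_slope m b (insert j S) t - hypercube_slope m b S t
      = (\<Sum>i=1..m. if i = j then 2 * b j * trig j t else 0)"
    unfolding hypercube_slope_def sum_subtractf[symmetric]
    using assms by (intro sum.cong) auto
  then show ?thesis using assms by simp
qed

context functional_linear_model
begin

lemma sets_sample_law:
  "sets (sample_law M X \<epsilon> \<sigma> n \<beta>) = sets (PiM {..<n} (\<lambda>_. borel \<Otimes>\<^sub>M borel_L2))"
  unfolding sample_law_def by (intro sets_PiM_cong) (simp_all add: observation_law_def)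

text \<open>The amplitudes \<open>b\<^sub>j = sqrt (\<kappa> / (n \<lambda>\<^sub>j))\<close> equalize the coordinates: each of the \<open>m\<close>
  coordinates contributes at least \<open>\<kappa> / (2 n)\<close> to the sum of two neighbouring risks, whatever its
  eigenvalue. The ellipsoid condition is exactly that the hypercube with these amplitudes belongs
  to the parameter set.\<close>

lemma minimax_lower_bound:
  assumes est: "est \<in> estimators n" and "n > 0"
    and "0 \<le> \<kappa>" "\<kappa> \<le> \<sigma>\<^sup>2"
    and ellipsoid: "(\<Sum>j=1..m. sobolev_weight p j * (\<kappa> / (n * lam j))) \<le> \<rho>"
  shows "ennreal (\<kappa> * m / (4 * n)) \<le> (SUP \<beta> \<in> sobolev_ellipsoid p \<rho>. prediction_risk M X \<epsilon> \<sigma> n est \<beta>)"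
    (is "_ \<le> ?V")
proof -
  define b where "b j = sqrt (\<kappa> / (n * lam j))" for j
  have b2: "(b j)\<^sup>2 = \<kappa> / (n * lam j)" if "j \<ge> 1" for j
    using that eigenvalue_pos[of j] \<open>0 \<le> \<kappa>\<close> by (simp add: b_def)
  have b_nonneg: "0 \<le> b j" if "j \<ge> 1" for j
    using that eigenvalue_pos[of j] \<open>0 \<le> \<kappa>\<close> by (simp add: b_def)
  define slope where "slope = hypercube_slope m b"
  have slope_L2: "slope S \<in> L2_01" for S
    by (simp add: slope_def hypercube_slope_L2_01)
  have slope_ellipsoid: "slope S \<in> sobolev_ellipsoid p \<rho>" for S
    unfolding slope_def using ellipsoid
    by (intro hypercube_slope_in_ellipsoid) (simp add: b2)
  define u where "u j D = inner01 (est D) (trig j)" for j D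
  have u_meas: "u j \<in> borel_measurable (PiM {..<n} (\<lambda>_. borel \<Otimes>\<^sub>M borel_L2))" for j
    unfolding u_def
    using est by (intro measurable_compose[OF _ inner01_measurable_borel_L2[OF trig_L2_01]])
      (simp add: estimators_def)
  define theta where "theta S j = (if j \<in> S then b j else - b j)" for S j
  let ?R = "lborel \<Otimes>\<^sub>M regressor_law"
  have sets_R: "sets (PiM {..<n} (\<lambda>_. ?R)) = sets (PiM {..<n} (\<lambda>_. borel \<Otimes>\<^sub>M borel_L2))"
    by (intro sets_PiM_cong refl sets_pair_measure_cong) simp_all
  define risk where
    "risk S j = ennreal (lam j) * (\<integral>\<^sup>+ D. ennreal ((u j D - theta S j)\<^sup>2)
      \<partial>sample_law M X \<epsilon> \<sigma> n (slope S))" for S j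
  have "of_nat (card {1..m}) * ennreal (\<kappa> / (2 * n)) \<le> 2 * ?V"
  proof (rule Assouad_averaging[where f = risk])
    show "finite {1..m}" by simp
    fix j S assume j: "j \<in> {1..m}" and S: "S \<subseteq> {1..m} - {j}"
    define P where "P S D = (\<Prod>i<n. observation_density (slope S) (D i))" for S D
    have P_meas: "P S \<in> borel_measurable (PiM {..<n} (\<lambda>_. ?R))" for S
      unfolding P_def using observation_density_measurable[OF slope_L2]
      by (intro borel_measurable_prod measurable_compose[OF measurable_component_singleton]) auto
    have P_nonneg: "0 \<le> P S D" for S D
      by (simp add: P_def prod_nonneg observation_density_nonneg)
    have law: "sample_law M X \<epsilon> \<sigma> n (slope S) = density (PiM {..<n} (\<lambda>_. ?R)) (P S)" for S
      unfolding P_def by (rule sample_law_eq_density[OF slope_L2])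
    have mass: "(\<integral>\<^sup>+ D. ennreal (P S D) \<partial>PiM {..<n} (\<lambda>_. ?R)) \<le> 1" for S
    proof -
      have "prob_space (sample_law M X \<epsilon> \<sigma> n (slope S))"
        unfolding sample_law_def by (intro prob_space_PiM prob_space_observation_law slope_L2)
      have "emeasure (density (PiM {..<n} (\<lambda>_. ?R)) (P S)) (space (PiM {..<n} (\<lambda>_. ?R))) = 1"
        using prob_space.emeasure_space_1[OF \<open>prob_space _\<close>] unfolding law by simp
      then show ?thesis
        using P_meas by (subst (asm) emeasure_density) (auto simp: indicator_def cong: nn_integral_cong)
    qed
    \<comment> \<open>The vertex \<open>insert j S\<close> has coefficient \<open>b\<^sub>j\<close> in coordinate \<open>j\<close>, the vertex \<open>S\<close> has \<open>- b\<^sub>j\<close>.\<close>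
    have "ennreal (2 * (b j)\<^sup>2 * (1 / 2)\<^sup>2)
        \<le> (\<integral>\<^sup>+ D. ennreal ((u j D - b j)\<^sup>2) \<partial>density (PiM {..<n} (\<lambda>_. ?R)) (P (insert j S)))
        + (\<integral>\<^sup>+ D. ennreal ((u j D + b j)\<^sup>2) \<partial>density (PiM {..<n} (\<lambda>_. ?R)) (P S))"
    proof (rule two_point_quadratic_risk)
      show "u j \<in> borel_measurable (PiM {..<n} (\<lambda>_. ?R))"
        using u_meas measurable_cong_sets[OF sets_R refl] by blast
      have "(inner01 (X \<omega>) (\<lambda>t. slope (insert j S) t - slope S t))\<^sup>2
          = 4 * (b j)\<^sup>2 * (inner01 (X \<omega>) (trig j))\<^sup>2" for \<omega>
      proof -
        have "(\<lambda>t. slope (insert j S) t - slope S t) = (\<lambda>t. (2 * b j) * trig j t)"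
          using j S unfolding slope_def by (intro ext hypercube_slope_insert_diff) auto
        then have "inner01 (X \<omega>) (\<lambda>t. slope (insert j S) t - slope S t) = 2 * b j * inner01 (X \<omega>) (trig j)"
          by (simp only: inner01_commute[of "X \<omega>"] inner01_scale)
        then show ?thesis by (simp add: power_mult_distrib)
      qed
      then have "real n * expectation (\<lambda>\<omega>. (inner01 (X \<omega>) (\<lambda>t. slope (insert j S) t - slope S t))\<^sup>2)
          = real n * (4 * (b j)\<^sup>2 * lam j)"
        using j by (simp add: eigenvalue[of j])
      also have "\<dots> = 4 * \<kappa>"
        using j \<open>n > 0\<close> eigenvalue_pos[of j] by (simp add: b2)
      finally show "ennreal (1 / 2) \<le> (\<integral>\<^sup>+ D. ennreal (sqrt (P (insert j S) D * P S D))
        \<partial>PiM {..<n} (\<lambda>_. ?R))"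
        unfolding P_def using \<open>\<kappa> \<le> \<sigma>\<^sup>2\<close> by (intro sample_affinity slope_L2) simp
    qed (use j in \<open>auto intro: P_meas P_nonneg mass b_nonneg\<close>)
    then have "ennreal (lam j) * ennreal (2 * (b j)\<^sup>2 * (1 / 2)\<^sup>2) \<le> risk (insert j S) j + risk S j"
      using S unfolding risk_def distrib_left[symmetric] law
      by (intro mult_left_mono) (auto simp: theta_def)
    moreover have "ennreal (lam j) * ennreal (2 * (b j)\<^sup>2 * (1 / 2)\<^sup>2) = ennreal (\<kappa> / (2 * n))"
    proof -
      have "lam j * (2 * (b j)\<^sup>2 * (1 / 2)\<^sup>2) = \<kappa> / (2 * n)"
        using j eigenvalue_pos[of j] by (simp add: b2 power_divide)
      then show ?thesis
        using j eigenvalue_pos[of j] by (subst ennreal_mult[symmetric]) auto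
    qed
    ultimately show "ennreal (\<kappa> / (2 * n)) \<le> risk S j + risk (insert j S) j"
      by (simp add: add.commute)
  next
    fix S assume "S \<subseteq> {1..m}"
    let ?P = "sample_law M X \<epsilon> \<sigma> n (slope S)"
    have [measurable]: "u j \<in> borel_measurable ?P" for j
      using u_meas measurable_cong_sets[OF sets_sample_law refl] by blast
    have "(\<Sum>j=1..m. risk S j) = (\<integral>\<^sup>+ D. (\<Sum>j=1..m. ennreal (lam j) * ennreal ((u j D - theta S j)\<^sup>2)) \<partial>?P)"
      unfolding risk_def by (simp add: nn_integral_sum nn_integral_cmult)
    also have "\<dots> \<le> prediction_risk M X \<epsilon> \<sigma> n est (slope S)"
      unfolding prediction_risk_def
    proof (rule nn_integral_mono)
      fix D assume "D \<in> space ?P"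
      then have "D \<in> space (PiM {..<n} (\<lambda>_. borel \<Otimes>\<^sub>M borel_L2))"
        using sets_eq_imp_space_eq[OF sets_sample_law] by blast
      moreover have "est \<in> PiM {..<n} (\<lambda>_. borel \<Otimes>\<^sub>M borel_L2) \<rightarrow>\<^sub>M borel_L2"
        using est by (simp add: estimators_def)
      ultimately have est_L2: "est D \<in> L2_01"
        using measurable_space[of est _ borel_L2 D] by simp
      have "(\<Sum>j=1..m. ennreal (lam j) * ennreal ((u j D - theta S j)\<^sup>2))
          = ennreal (\<Sum>j=1..m. lam j * (inner01 (\<lambda>t. est D t - slope S t) (trig j))\<^sup>2)"
        using est_L2 slope_L2 eigenvalue_pos
        by (subst sum_ennreal[symmetric])
           (auto intro!: sum.cong mult_nonneg_nonneg less_imp_le[OF eigenvalue_pos]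
             simp: ennreal_mult less_imp_le inner01_diff trig_L2_01 u_def theta_def
             slope_def inner01_hypercube_slope)
      also have "\<dots> \<le> ennreal (inner01 (cov_operator M X (\<lambda>t. est D t - slope S t))
          (\<lambda>t. est D t - slope S t))"
        by (intro ennreal_leI cov_operator_Bessel L2_01_diff est_L2 slope_L2) auto
      finally show "(\<Sum>j=1..m. ennreal (lam j) * ennreal ((u j D - theta S j)\<^sup>2))
          \<le> ennreal (inner01 (cov_operator M X (\<lambda>t. est D t - slope S t)) (\<lambda>t. est D t - slope S t))" .
    qed
    also have "\<dots> \<le> ?V" by (intro SUP_upper slope_ellipsoid)
    finally show "(\<Sum>j=1..m. risk S j) \<le> ?V" .
  qed
  moreover have "of_nat (card {1..m}) * ennreal (\<kappa> / (2 * n)) = 2 * ennreal (\<kappa> * m / (4 * n))"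
    using \<open>0 \<le> \<kappa>\<close> by (simp add: ennreal_mult[symmetric] ennreal_of_nat_eq_real_of_nat field_simps
        flip: ennreal_numeral)
  ultimately show ?thesis
    by (simp add: ennreal_mult_le_mult_iff)
qed

end


section \<open>Choice of the dimension\<close>

text \<open>Rounding the ideal dimension down to an integer costs at most a factor of two.\<close>

lemma le_twice_floor:
  fixes x :: real
  assumes "x \<ge> 1"
  shows "x \<le> 2 * real (nat \<lfloor>x\<rfloor>)"
proof -
  have "1 \<le> \<lfloor>x\<rfloor>" using assms by simp
  then have "1 \<le> real_of_int \<lfloor>x\<rfloor>" "real (nat \<lfloor>x\<rfloor>) = real_of_int \<lfloor>x\<rfloor>" by linarith+
  then show ?thesis using real_of_int_floor_add_one_gt[of x] by linarith
qed

lemma sobolev_weight_le: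
  assumes "p \<ge> 0" "j \<ge> 1"
  shows "sobolev_weight p j \<le> real j powr (2 * p)"
proof (cases "j = 1")
  case False
  then have "real (j div 2) powr (2 * p) \<le> real j powr (2 * p)"
    using assms by (intro powr_mono2) auto
  then show ?thesis using False assms by (simp add: sobolev_weight_def)
qed (simp add: sobolev_weight_def)

lemma sobolev_weight_nonneg: "0 \<le> sobolev_weight p j"
  by (simp add: sobolev_weight_def)

context functional_linear_model
begin

text \<open>Only the growth of \<open>\<Sum>\<^bsub>j\<le>m\<^esub> w\<^sub>j / \<lambda>\<^sub>j\<close> matters for the rate: if it is at most of order \<open>n\<close> at
  the dimension \<open>m n\<close>, then \<open>m n / n\<close> is a lower bound up to constants.\<close>

lemma minimax_rate:
  fixes m :: "nat \<Rightarrow> nat" and r :: "nat \<Rightarrow> real" and K B \<rho> :: real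
  assumes "\<rho> > 0" "K > 0" "B > 0"
    and dimension: "\<forall>\<^sub>F n in sequentially.
      (\<Sum>j=1..m n. sobolev_weight p j / lam j) \<le> K * n \<and> r n \<le> B * (m n / n)"
  shows "\<exists>C > 0. \<forall>\<^sub>F n in sequentially. \<forall>est \<in> estimators n.
    ennreal (r n) \<le> ennreal C * (SUP \<beta> \<in> sobolev_ellipsoid p \<rho>. prediction_risk M X \<epsilon> \<sigma> n est \<beta>)"
proof -
  \<comment> \<open>Indistinguishability of neighbours and membership in the ellipsoid each cap the amplitude.\<close>
  define \<kappa> where "\<kappa> = min (\<sigma>\<^sup>2) (\<rho> / K)"
  have \<kappa>: "0 < \<kappa>" "\<kappa> \<le> \<sigma>\<^sup>2" "\<kappa> * K \<le> \<rho>"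
    using sigma_pos \<open>\<rho> > 0\<close> \<open>K > 0\<close> by (auto simp: \<kappa>_def min_def field_simps)
  have "\<forall>\<^sub>F n in sequentially. \<forall>est \<in> estimators n. ennreal (r n) \<le> ennreal (4 * B / \<kappa>)
      * (SUP \<beta> \<in> sobolev_ellipsoid p \<rho>. prediction_risk M X \<epsilon> \<sigma> n est \<beta>)"
    using dimension eventually_gt_at_top[of 0]
  proof eventually_elim
    case (elim n)
    have "(\<Sum>j=1..m n. sobolev_weight p j * (\<kappa> / (n * lam j)))
        = \<kappa> / n * (\<Sum>j=1..m n. sobolev_weight p j / lam j)"
      by (simp add: sum_distrib_left mult.commute)
    also have "\<dots> \<le> \<kappa> / n * (K * n)"
      using elim \<kappa>(1) by (intro mult_left_mono) auto
    also have "\<dots> \<le> \<rho>" using elim \<kappa>(3) by simp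
    finally have ellipsoid: "(\<Sum>j=1..m n. sobolev_weight p j * (\<kappa> / (n * lam j))) \<le> \<rho>" .
    show ?case
    proof
      fix est assume est: "est \<in> estimators n"
      have "r n \<le> 4 * B / \<kappa> * (\<kappa> * m n / (4 * n))"
        using elim \<kappa>(1) by simp
      then have "ennreal (r n) \<le> ennreal (4 * B / \<kappa> * (\<kappa> * m n / (4 * n)))"
        by (rule ennreal_leI)
      also have "\<dots> = ennreal (4 * B / \<kappa>) * ennreal (\<kappa> * m n / (4 * n))"
        using \<open>B > 0\<close> \<kappa>(1) by (intro ennreal_mult) auto
      also have "\<dots> \<le> ennreal (4 * B / \<kappa>)
          * (SUP \<beta> \<in> sobolev_ellipsoid p \<rho>. prediction_risk M X \<epsilon> \<sigma> n est \<beta>)"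
      proof (rule mult_left_mono)
        show "ennreal (\<kappa> * m n / (4 * n))
            \<le> (SUP \<beta> \<in> sobolev_ellipsoid p \<rho>. prediction_risk M X \<epsilon> \<sigma> n est \<beta>)"
          using minimax_lower_bound[OF est _ _ \<kappa>(2) ellipsoid] elim \<kappa>(1) by simp
      qed simp
      finally show "ennreal (r n) \<le> ennreal (4 * B / \<kappa>)
          * (SUP \<beta> \<in> sobolev_ellipsoid p \<rho>. prediction_risk M X \<epsilon> \<sigma> n est \<beta>)" .
    qed
  qed
  then show ?thesis using \<open>B > 0\<close> \<kappa>(1) by (intro exI[of _ "4 * B / \<kappa>"]) auto
qed

text \<open>Each summand is bounded by its largest possible value up to index \<open>m\<close>, with \<open>h\<close> an upper
  bound for \<open>1 / \<upsilon>\<^sub>j\<close>. Estimating the sum by \<open>m\<close> times this value loses only factors that the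
  rates do not see.\<close>

lemma weight_eigenvalue_ratio_le:
  assumes "lam \<in> eigenvalue_class \<upsilon> d" "d \<ge> 1" "p \<ge> 0" "j \<ge> 1" "j \<le> m"
    and "0 < \<upsilon> j" "1 / \<upsilon> j \<le> h"
  shows "sobolev_weight p j / lam j \<le> real m powr (2 * p) * (d * h)"
proof -
  have "1 / d \<le> lam j / \<upsilon> j"
    using assms by (auto simp: eigenvalue_class_def)
  then have "1 / lam j \<le> d * (1 / \<upsilon> j)"
    using \<open>0 < \<upsilon> j\<close> \<open>d \<ge> 1\<close> eigenvalue_pos[OF \<open>j \<ge> 1\<close>] by (simp add: field_simps)
  also have "\<dots> \<le> d * h" using assms by (intro mult_left_mono) auto
  finally have "1 / lam j \<le> d * h" .
  moreover have "sobolev_weight p j \<le> real m powr (2 * p)"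
    using sobolev_weight_le[of p j] powr_mono2[of "2 * p" "real j" "real m"] assms by simp
  ultimately have "sobolev_weight p j * (1 / lam j) \<le> real m powr (2 * p) * (d * h)"
    using eigenvalue_pos[OF \<open>j \<ge> 1\<close>] by (intro mult_mono) (auto simp: sobolev_weight_nonneg)
  then show ?thesis by simp
qed

text \<open>The sum of \<open>m\<close> terms of size \<open>d\<close> times \<open>m\<close> to the power \<open>2p + 2a\<close> stays below \<open>d n\<close> when \<open>m\<close>
  is at most \<open>n\<close> to the power \<open>1 / q\<close> with \<open>q = 2p + 2a + 1\<close>.\<close>

lemma polynomial_rate:
  assumes lam: "lam \<in> eigenvalue_class (poly_rate_seq a) d" and "a > 0" "d \<ge> 1" "p \<ge> 0" "\<rho> > 0"
  shows "\<exists>C > 0. \<forall>\<^sub>F n in sequentially. \<forall>est \<in> estimators n.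
    ennreal (real n powr (- (2 * p + 2 * a) / (2 * p + 2 * a + 1)))
      \<le> ennreal C * (SUP \<beta> \<in> sobolev_ellipsoid p \<rho>. prediction_risk M X \<epsilon> \<sigma> n est \<beta>)"
proof -
  define q where "q = 2 * p + 2 * a + 1"
  define m where "m n = nat \<lfloor>real n powr (1 / q)\<rfloor>" for n :: nat
  have "q > 1" using assms by (simp add: q_def)
  have "(\<Sum>j=1..m n. sobolev_weight p j / lam j) \<le> d * n
      \<and> real n powr (- (2 * p + 2 * a) / q) \<le> 2 * (m n / n)" if "n > 0" for n
  proof
    have m_le: "real (m n) \<le> real n powr (1 / q)" by (simp add: m_def)
    have "n powr (1 / q) \<ge> 1"
      using that \<open>q > 1\<close> by (intro ge_one_powr_ge_zero) auto
    then have m_ge: "real n powr (1 / q) \<le> 2 * real (m n)"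
      unfolding m_def by (rule le_twice_floor)
    with \<open>n powr (1 / q) \<ge> 1\<close> have "m n > 0" by (cases "m n") auto
    have "(\<Sum>j=1..m n. sobolev_weight p j / lam j)
        \<le> (\<Sum>j=1..m n. real (m n) powr (2 * p) * (d * real (m n) powr (2 * a)))"
    proof (rule sum_mono)
      fix j assume j: "j \<in> {1..m n}"
      have seq: "poly_rate_seq a j = real j powr (- (2 * a))"
        using j by (cases "j = 1") (auto simp: poly_rate_seq_def)
      show "sobolev_weight p j / lam j \<le> real (m n) powr (2 * p) * (d * real (m n) powr (2 * a))"
      proof (rule weight_eigenvalue_ratio_le[OF lam])
        show "1 / poly_rate_seq a j \<le> real (m n) powr (2 * a)"
          using j \<open>a > 0\<close> by (simp add: seq powr_minus_divide powr_mono2)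
      qed (use j assms in \<open>auto simp: seq\<close>)
    qed
    also have "\<dots> = d * real (m n) powr q"
      using \<open>m n > 0\<close> by (simp add: q_def powr_add)
    also have "\<dots> \<le> d * (real n powr (1 / q)) powr q"
      using m_le \<open>q > 1\<close> \<open>d \<ge> 1\<close> by (intro mult_left_mono powr_mono2) auto
    also have "\<dots> = d * n" using \<open>q > 1\<close> that by (simp add: powr_powr)
    finally show "(\<Sum>j=1..m n. sobolev_weight p j / lam j) \<le> d * n" .
    have "real n powr (- (2 * p + 2 * a) / q) = real n powr (1 / q - 1)"
      using \<open>q > 1\<close> by (simp add: q_def field_simps)
    also have "\<dots> = real n powr (1 / q) / n"
      using that by (simp add: powr_diff)
    also have "\<dots> \<le> 2 * (m n / n)"
      using m_ge that by (simp add: divide_right_mono)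
    finally show "real n powr (- (2 * p + 2 * a) / q) \<le> 2 * (m n / n)" .
  qed
  then have "\<forall>\<^sub>F n in sequentially. (\<Sum>j=1..m n. sobolev_weight p j / lam j) \<le> d * n
      \<and> real n powr (- (2 * p + 2 * a) / q) \<le> 2 * (m n / n)"
    using eventually_gt_at_top[of 0] by (rule eventually_mono[rotated])
  from minimax_rate[OF \<open>\<rho> > 0\<close> _ _ this] show ?thesis
    using \<open>d \<ge> 1\<close> by (simp add: q_def)
qed

text \<open>The dimension is chosen with \<open>ln n / 2\<close> in place of \<open>ln n\<close>: the exponential term is then at
  most the square root of \<open>n\<close>, and the other square root of \<open>n\<close> absorbs the power of \<open>m\<close> that
  comes from the Sobolev weights and the number of terms.\<close>

lemma exponential_rate:
  assumes lam: "lam \<in> eigenvalue_class (exp_rate_seq a) d" and "a > 0" "d \<ge> 1" "p \<ge> 0" "\<rho> > 0"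
  shows "\<exists>C > 0. \<forall>\<^sub>F n in sequentially. \<forall>est \<in> estimators n.
    ennreal (1 / real n * ln (real n) powr (1 / (2 * a)))
      \<le> ennreal C * (SUP \<beta> \<in> sobolev_ellipsoid p \<rho>. prediction_risk M X \<epsilon> \<sigma> n est \<beta>)"
proof -
  define L where "L n = ln (real n) / 2" for n :: nat
  define m where "m n = nat \<lfloor>L n powr (1 / (2 * a))\<rfloor>" for n :: nat
  define B where "B = 2 * 2 powr (1 / (2 * a))"
  have "(1 + 2 * p) / (2 * a) > 0" using assms by simp
  then have "\<forall>\<^sub>F n in sequentially. L n powr ((1 + 2 * p) / (2 * a)) \<le> real n powr (1 / 2)"
    unfolding L_def by real_asymp
  moreover have "\<forall>\<^sub>F n in sequentially. L n \<ge> 1"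
    unfolding L_def by real_asymp
  ultimately have "\<forall>\<^sub>F n in sequentially. (\<Sum>j=1..m n. sobolev_weight p j / lam j) \<le> d * n
      \<and> 1 / real n * ln (real n) powr (1 / (2 * a)) \<le> B * (m n / n)"
    using eventually_gt_at_top[of 0]
  proof eventually_elim
    case (elim n)
    have m_le: "real (m n) \<le> L n powr (1 / (2 * a))" by (simp add: m_def)
    have "L n powr (1 / (2 * a)) \<ge> 1"
      using elim \<open>a > 0\<close> by (intro ge_one_powr_ge_zero) auto
    then have m_ge: "L n powr (1 / (2 * a)) \<le> 2 * real (m n)"
      unfolding m_def by (rule le_twice_floor)
    with \<open>L n powr (1 / (2 * a)) \<ge> 1\<close> have "m n > 0" by (cases "m n") auto
    have "real (m n) powr (2 * a) \<le> (L n powr (1 / (2 * a))) powr (2 * a)"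
      using m_le \<open>a > 0\<close> by (intro powr_mono2) auto
    also have "\<dots> = L n" using \<open>a > 0\<close> elim by (simp add: powr_powr)
    finally have "exp (real (m n) powr (2 * a)) \<le> exp (L n)" by simp
    also have "\<dots> = real n powr (1 / 2)" using elim by (simp add: L_def powr_def)
    finally have exp_le: "exp (real (m n) powr (2 * a)) \<le> real n powr (1 / 2)" .
    have "(\<Sum>j=1..m n. sobolev_weight p j / lam j)
        \<le> (\<Sum>j=1..m n. real (m n) powr (2 * p) * (d * exp (real (m n) powr (2 * a))))"
    proof (rule sum_mono)
      fix j assume j: "j \<in> {1..m n}"
      then have "real j powr (2 * a) \<le> real (m n) powr (2 * a)"
        using \<open>a > 0\<close> by (intro powr_mono2) auto
      show "sobolev_weight p j / lam j \<le> real (m n) powr (2 * p) * (d * exp (real (m n) powr (2 * a)))"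
      proof (rule weight_eigenvalue_ratio_le[OF lam])
        show "1 / exp_rate_seq a j \<le> exp (real (m n) powr (2 * a))"
          using \<open>real j powr (2 * a) \<le> real (m n) powr (2 * a)\<close>
          by (auto simp: exp_rate_seq_def exp_minus divide_inverse)
      qed (use j assms in \<open>auto simp: exp_rate_seq_def\<close>)
    qed
    also have "\<dots> = d * (real (m n) powr (1 + 2 * p) * exp (real (m n) powr (2 * a)))"
      using \<open>m n > 0\<close> by (simp add: powr_add)
    also have "\<dots> \<le> d * (real n powr (1 / 2) * real n powr (1 / 2))"
    proof (intro mult_left_mono mult_mono exp_le)
      have "real (m n) powr (1 + 2 * p) \<le> (L n powr (1 / (2 * a))) powr (1 + 2 * p)"
        using m_le \<open>p \<ge> 0\<close> by (intro powr_mono2) auto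
      also have "\<dots> \<le> real n powr (1 / 2)" using elim by (simp add: powr_powr)
      finally show "real (m n) powr (1 + 2 * p) \<le> real n powr (1 / 2)" .
    qed (use \<open>d \<ge> 1\<close> in auto)
    also have "\<dots> = d * n" by (simp flip: powr_add)
    finally have "(\<Sum>j=1..m n. sobolev_weight p j / lam j) \<le> d * n" .
    moreover have "1 / real n * ln (real n) powr (1 / (2 * a)) \<le> B * (m n / n)"
    proof -
      have "ln (real n) powr (1 / (2 * a)) = 2 powr (1 / (2 * a)) * L n powr (1 / (2 * a))"
        using elim by (simp add: L_def flip: powr_mult)
      also have "\<dots> \<le> 2 powr (1 / (2 * a)) * (2 * real (m n))"
        using m_ge by (intro mult_left_mono) auto
      finally have "ln (real n) powr (1 / (2 * a)) \<le> B * real (m n)" by (simp add: B_def)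
      then show ?thesis using elim by (simp add: divide_right_mono)
    qed
    ultimately show ?case by blast
  qed
  from minimax_rate[OF \<open>\<rho> > 0\<close> _ _ this] show ?thesis
    using \<open>d \<ge> 1\<close> by (simp add: B_def)
qed

end

theorem proposition4p1:
  fixes M :: "'w measure"
    and X :: "'w \<Rightarrow> real \<Rightarrow> real"
    and c :: "real \<Rightarrow> real"
    and lam :: "nat \<Rightarrow> real"
    and \<epsilon> :: "'w \<Rightarrow> real"
    and \<sigma> d p \<rho> :: real
  assumes "second_order_stationary_regressor M X c lam"
    and "standard_normal_indep_error M X \<epsilon>"
    and "\<sigma> > 0"
    and "d \<ge> 1"
    and "p \<ge> 0"
    and "\<rho> > 0"
  shows "(\<forall>a > 1 / 2. lam \<in> eigenvalue_class (poly_rate_seq a) d \<longrightarrow>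
      (\<exists>C > 0. \<forall>\<^sub>F n in sequentially. \<forall>est \<in> estimators n.
        ennreal (real n powr (- (2 * p + 2 * a) / (2 * p + 2 * a + 1)))
          \<le> ennreal C * (SUP \<beta> \<in> sobolev_ellipsoid p \<rho>. prediction_risk M X \<epsilon> \<sigma> n est \<beta>)))
    \<and> (\<forall>a > 0. lam \<in> eigenvalue_class (exp_rate_seq a) d \<longrightarrow>
      (\<exists>C > 0. \<forall>\<^sub>F n in sequentially. \<forall>est \<in> estimators n.
        ennreal (1 / real n * ln (real n) powr (1 / (2 * a)))
          \<le> ennreal C * (SUP \<beta> \<in> sobolev_ellipsoid p \<rho>. prediction_risk M X \<epsilon> \<sigma> n est \<beta>)))"
proof -
  interpret second_order_stationary_regressor M X c lam by fact
  interpret functional_linear_model M X c lam \<epsilon> \<sigma>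
    by standard (use assms in auto)
  show ?thesis
    using assms(4-6) by (intro conjI allI impI polynomial_rate exponential_rate) auto
qed

end
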